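(* Let $d\ge 1$ and let $P\subset\mathbb{RP}^d$ be a closed polygon with $n\ge d+1$ vertices $V_1,\dots,V_n$ in general position. If $P$ is strictly convex, then $P$ has at least $d+1$ flattenings, i.e. there are at least $d+1$ indices $i\in\mathbb{Z}/n$ such that the $d$-tuple of consecutive vertices $(V_i,\dots,V_{i+d-1})$ is a flattening of $P$.
   Context: A closed polygon $P\subset\mathbb{RP}^d$ with vertices $V_1,\dots,V_n$ (indices are cyclic, $V_{n+1}=V_1$, etc.) is the closed broken line obtained by joining each pair of consecutive vertices $V_i,V_{i+1}$ by an edge, namely one chosen segment (of the two possible) of the projective line through $V_i$ and $V_{i+1}$. General position: for every $k\le d+1$ and every set of $k$ distinct vertices $V_{i_1},\dots,V_{i_k}$, their projective span is $(k-1)$-dimensional. Transversality: $P$ is transverse to a hyperplane $H$ at a point $X\in P\cap H$ if either (a) $X$ is an interior point of an edge and this edge is transverse to $H$, or (b) $X$ is a vertex, the two edges incident to $X$ are transverse to $H$ and are locally separated by $H$. $P$ is transverse to $H$ if it is transverse at every point of $P\cap H$. Multiplicity: $P$ intersects a hyperplane $H$ with multiplicity $k$ if for every hyperplane $H'$ sufficiently close to $H$ and transverse to $P$ the number of points of $P\cap H'$ does not exceed $k$ and, moreover, $k$ is achieved for some such $H'$. (Vertices of $P$ are allowed to lie in $H$.) Strict convexity: $P$ is strictly convex if through every $d-1$ vertices of $P$ there passes a hyperplane $H$ such that the multiplicity of its intersection with $P$ equals $d-1$. Separation: given a continuous curve in $\mathbb{RP}^d$ with endpoints $A$ and $Z$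 and a hyperplane $H$ containing neither $A$ nor $Z$, one says that $A$ and $Z$ are on one side of $H$ (not separated by $H$) if one can connect $A$ and $Z$ by a curve not intersecting $H$ such that the closed curve obtained together with the given curve is contractible; otherwise $A$ and $Z$ are separated by $H$. Flattening: a $d$-tuple of consecutive vertices $(V_i,\dots,V_{i+d-1})$ of $P$ is a flattening if the endpoints $V_{i-1}$ and $V_{i+d}$ of the broken line $(V_{i-1},\dots,V_{i+d})$ (formed by consecutive edges of $P$) are: (a) separated by the hyperplane through $V_i,\dots,V_{i+d-1}$ if $d$ is even; (b) not separated by it if $d$ is odd. Here separation is with respect to that broken line. *)

theory Defs
  imports "HOL-Analysis.Analysis"
begin

text \<open>For \<open>CARD('n) = d + 1\<close>, \<open>'n projspace\<close> is the real projective space of dimension \<open>d\<close>: its points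
  are the lines through the origin of \<open>real ^ 'n\<close>.\<close>

typedef ('n::finite) projspace = "{L :: (real ^ 'n) set. subspace L \<and> dim L = 1}"
  morphisms line Abs_projspace
proof -
  have "subspace (span {axis undefined (1::real) :: real ^ 'n})"
    by simp
  moreover have "dim (span {axis undefined (1::real) :: real ^ 'n}) = 1"
    by (simp add: dim_insert axis_eq_0_iff)
  ultimately show ?thesis
    by blast
qed

text \<open>The point with homogeneous coordinates \<open>v\<close>; only meaningful for \<open>v \<noteq> 0\<close>.\<close>

definition proj_pt :: "real ^ 'n \<Rightarrow> ('n::finite) projspace" where
  "proj_pt v = Abs_projspace (span {v})"

lemma line_proj_pt: "v \<noteq> 0 \<Longrightarrow> line (proj_pt v) = span {v}"
  unfolding proj_pt_def by (rule Abs_projspace_inverse) (simp add: dim_insert)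

text \<open>The quotient topology with respect to \<^const>\<open>proj_pt\<close> on the nonzero vectors.\<close>

instantiation projspace :: (finite) topological_space
begin

definition open_projspace :: "'a projspace set \<Rightarrow> bool" where
  "open_projspace U \<longleftrightarrow> open {v. v \<noteq> 0 \<and> proj_pt v \<in> U}"

instance
proof
  have "{v :: real ^ 'a. v \<noteq> 0 \<and> proj_pt v \<in> UNIV} = - {0}"
    by auto
  then show "open (UNIV :: 'a projspace set)"
    by (simp add: open_projspace_def open_Compl)
next
  fix S T :: "'a projspace set"
  assume "open S" "open T"
  moreover have "{v. v \<noteq> 0 \<and> proj_pt v \<in> S \<inter> T} =
      {v. v \<noteq> 0 \<and> proj_pt v \<in> S} \<inter> {v. v \<noteq> 0 \<and> proj_pt v \<in> T}"
    by auto
  ultimately show "open (S \<inter> T)"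
    by (simp add: open_projspace_def open_Int)
next
  fix K :: "'a projspace set set"
  assume "\<forall>S\<in>K. open S"
  moreover have "{v. v \<noteq> 0 \<and> proj_pt v \<in> \<Union>K} = (\<Union>S\<in>K. {v. v \<noteq> 0 \<and> proj_pt v \<in> S})"
    by auto
  ultimately show "open (\<Union>K)"
    by (simp add: open_projspace_def open_UN)
qed

end

definition span_dim :: "('n::finite) projspace set \<Rightarrow> int" where
  "span_dim S = int (dim (\<Union>X\<in>S. line X)) - 1"

text \<open>Hyperplanes are parametrised by the dual projective space, which the inner product
  identifies with \<^typ>\<open>'n projspace\<close> itself. The topology of the latter is what closeness of
  hyperplanes refers to.\<close>

definition hyperplane :: "('n::finite) projspace \<Rightarrow> 'n projspace set" where
  "hyperplane h = {X. \<forall>x\<in>line X. \<forall>y\<in>line h. x \<bullet> y = 0}"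


text \<open>A parametrisation of a segment with distinct endpoints \<open>A\<close> and \<open>B\<close>. Replacing \<open>w\<close> by \<open>- w\<close>
  exchanges the two segments of the projective line through \<open>A\<close> and \<open>B\<close>.\<close>

definition segment_path ::
    "(real \<Rightarrow> ('n::finite) projspace) \<Rightarrow> 'n projspace \<Rightarrow> 'n projspace \<Rightarrow> bool" where
  "segment_path e A B \<longleftrightarrow>
     (\<exists>v w. v \<noteq> 0 \<and> w \<noteq> 0 \<and> A = proj_pt v \<and> B = proj_pt w \<and> A \<noteq> B \<and>
        e = (\<lambda>t. proj_pt ((1 - t) *\<^sub>R v + t *\<^sub>R w)))"

text \<open>The closed polygon with vertices \<open>V i\<close>, where \<open>e i\<close> is the edge from \<open>V i\<close> to \<open>V (i + 1)\<close>;
  cyclic indices are rendered as \<open>n\<close>-periodic families over the integers.\<close>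

definition closed_polygon ::
    "nat \<Rightarrow> (int \<Rightarrow> ('n::finite) projspace) \<Rightarrow> (int \<Rightarrow> real \<Rightarrow> 'n projspace) \<Rightarrow> bool" where
  "closed_polygon n V e \<longleftrightarrow>
     (\<forall>i. V (i + int n) = V i \<and> e (i + int n) = e i \<and> segment_path (e i) (V i) (V (i + 1)))"

definition polygon_points :: "(int \<Rightarrow> real \<Rightarrow> ('n::finite) projspace) \<Rightarrow> 'n projspace set" where
  "polygon_points e = (\<Union>i. path_image (e i))"

definition general_position :: "nat \<Rightarrow> nat \<Rightarrow> (int \<Rightarrow> ('n::finite) projspace) \<Rightarrow> bool" where
  "general_position d n V \<longleftrightarrow>
     (\<forall>I \<subseteq> {0..<int n}. card I \<le> d + 1 \<longrightarrow> span_dim (V ` I) = int (card I) - 1)"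

text \<open>A projective line is transverse to a hyperplane iff it is not contained in it, and an edge
  contained in a hyperplane spans a line contained in it.\<close>

definition edge_transverse :: "(real \<Rightarrow> ('n::finite) projspace) \<Rightarrow> 'n projspace \<Rightarrow> bool" where
  "edge_transverse a h \<longleftrightarrow> \<not> path_image a \<subseteq> hyperplane h"

text \<open>Near \<open>X\<close>, the arcs \<open>a\<close> and \<open>b\<close> lie on different sides of the hyperplane. The open set \<open>U\<close>
  need not be connected: a small ball around \<open>X\<close> is cut by the hyperplane into two connected
  halves, and shrinking \<open>U\<close> to such a ball shows that no other \<open>U\<close> can separate more.\<close>

definition locally_separated ::
    "'n projspace \<Rightarrow> (real \<Rightarrow> 'n projspace) \<Rightarrow> (real \<Rightarrow> 'n projspace) \<Rightarrow> ('n::finite) projspace \<Rightarrow> bool"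
  where
  "locally_separated X a b h \<longleftrightarrow>
     (\<exists>U. open U \<and> X \<in> U \<and>
        (\<forall>Y \<in> path_image a \<inter> U - {X}. \<forall>Z \<in> path_image b \<inter> U - {X}.
           \<not> connected_component (U - hyperplane h) Y Z))"

definition transverse_at ::
    "(int \<Rightarrow> ('n::finite) projspace) \<Rightarrow> (int \<Rightarrow> real \<Rightarrow> 'n projspace) \<Rightarrow> 'n projspace \<Rightarrow> 'n projspace \<Rightarrow> bool"
  where
  "transverse_at V e h X \<longleftrightarrow>
     (\<exists>i. X \<in> e i ` {0<..<1} \<and> edge_transverse (e i) h) \<or>
     (\<exists>i. X = V i \<and> edge_transverse (e (i - 1)) h \<and> edge_transverse (e i) h \<and>
        locally_separated X (e (i - 1)) (e i) h)"

definition polygon_transverse ::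
    "(int \<Rightarrow> ('n::finite) projspace) \<Rightarrow> (int \<Rightarrow> real \<Rightarrow> 'n projspace) \<Rightarrow> 'n projspace \<Rightarrow> bool" where
  "polygon_transverse V e h \<longleftrightarrow>
     (\<forall>X \<in> polygon_points e \<inter> hyperplane h. transverse_at V e h X)"

text \<open>The bound holds on some neighbourhood of \<open>h\<close> and is attained in every neighbourhood of \<open>h\<close>,
  so that the multiplicity is unique when it exists.\<close>

definition intersects_with_multiplicity ::
    "(int \<Rightarrow> ('n::finite) projspace) \<Rightarrow> (int \<Rightarrow> real \<Rightarrow> 'n projspace) \<Rightarrow> 'n projspace \<Rightarrow> nat \<Rightarrow> bool"
  where
  "intersects_with_multiplicity V e h k \<longleftrightarrow>
     (\<forall>\<^sub>F h' in nhds h. polygon_transverse V e h' \<longrightarrow>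
        finite (polygon_points e \<inter> hyperplane h') \<and>
        card (polygon_points e \<inter> hyperplane h') \<le> k) \<and>
     (\<exists>\<^sub>F h' in nhds h. polygon_transverse V e h' \<and>
        finite (polygon_points e \<inter> hyperplane h') \<and>
        card (polygon_points e \<inter> hyperplane h') = k)"

definition strictly_convex ::
    "nat \<Rightarrow> nat \<Rightarrow> (int \<Rightarrow> ('n::finite) projspace) \<Rightarrow> (int \<Rightarrow> real \<Rightarrow> 'n projspace) \<Rightarrow> bool" where
  "strictly_convex d n V e \<longleftrightarrow>
     (\<forall>I \<subseteq> {0..<int n}. card I = d - 1 \<longrightarrow>
        (\<exists>h. V ` I \<subseteq> hyperplane h \<and> intersects_with_multiplicity V e h (d - 1)))"

definition contractible_loop :: "(real \<Rightarrow> 'a::topological_space) \<Rightarrow> bool" where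
  "contractible_loop g \<longleftrightarrow> (\<exists>a. homotopic_loops UNIV g (\<lambda>_. a))"

text \<open>The endpoints of the curve \<open>g\<close> are separated by the hyperplane, respectively are not.
  Both notions require that the endpoints do not lie in the hyperplane.\<close>

definition not_separated :: "(real \<Rightarrow> ('n::finite) projspace) \<Rightarrow> 'n projspace \<Rightarrow> bool" where
  "not_separated g h \<longleftrightarrow>
     pathstart g \<notin> hyperplane h \<and> pathfinish g \<notin> hyperplane h \<and>
     (\<exists>c. path c \<and> pathstart c = pathfinish g \<and> pathfinish c = pathstart g \<and>
        path_image c \<inter> hyperplane h = {} \<and> contractible_loop (g +++ c))"

definition separated :: "(real \<Rightarrow> ('n::finite) projspace) \<Rightarrow> 'n projspace \<Rightarrow> bool" where
  "separated g h \<longleftrightarrow>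
     pathstart g \<notin> hyperplane h \<and> pathfinish g \<notin> hyperplane h \<and> \<not> not_separated g h"

text \<open>\<open>broken_line e k i\<close> runs through the \<open>k + 1\<close> edges \<open>e i, \<dots>, e (i + k)\<close>.\<close>

primrec broken_line :: "(int \<Rightarrow> real \<Rightarrow> 'a::topological_space) \<Rightarrow> nat \<Rightarrow> int \<Rightarrow> real \<Rightarrow> 'a" where
  "broken_line e 0 i = e i"
| "broken_line e (Suc k) i = e i +++ broken_line e k (i + 1)"

definition flattening ::
    "nat \<Rightarrow> (int \<Rightarrow> ('n::finite) projspace) \<Rightarrow> (int \<Rightarrow> real \<Rightarrow> 'n projspace) \<Rightarrow> int \<Rightarrow> bool" where
  "flattening d V e i \<longleftrightarrow>
     (\<exists>h. V ` {i..<i + int d} \<subseteq> hyperplane h \<and>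
        (if even d then separated (broken_line e d (i - 1)) h
         else not_separated (broken_line e d (i - 1)) h))"

end

theory Submission
  imports Defs
begin

text \<open>Lift the vertices to vectors \<open>v i\<close> such that each edge is the image of the segment from \<open>v i\<close> to
  \<open>v (i + 1)\<close>; then \<open>v (i + n) = l *\<^sub>R v i\<close> for a constant \<open>l\<close>. Flattenings correspond to the sign changes of
  the determinants \<open>\<Delta> i\<close> of \<open>v i, \<dots>, v (i + d)\<close>, and one shows by induction on \<open>n\<close> that there are at least
  \<open>d + 1\<close> of them in a period. For a simplex, convexity determines the sign of \<open>l\<close>, and then every
  \<open>\<Delta> (i + 1)\<close> has the sign opposite to \<open>\<Delta> i\<close>. Otherwise delete a vertex. A determinant of the
  smaller polygon that skips the deleted vertex lies between \<open>\<Delta> i\<close> and \<open>\<Delta> (i + 1)\<close>, and convexity forces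
  it to share its sign with one of them: if not, the linear relation between the \<open>d + 2\<close> vectors involved shows
  that a hyperplane through the \<open>d - 1\<close> vertices other than the two ends and the deleted one can be
  perturbed so as to meet \<open>d\<close> edges of the window. Hence the deletion creates no sign changes.\<close>

subsection \<open>Linearly independent families\<close>

text \<open>The parity clause turns both kinds of flattenings into one event. The functional
  \<open>w \<mapsto> det (w, v (i + 1), ..., v (i + d))\<close> has the value
  \<open>\<Delta> i\<close> at \<open>v i\<close> and \<open>(-1) ^ d * \<Delta> (i + 1)\<close> at
  \<open>v (i + d + 1)\<close>. A sign change of \<open>\<Delta>\<close> therefore puts the two ends
  on different sides in the lift for even \<open>d\<close> and on the same side for odd
  \<open>d\<close>, which is what separation along the broken line asks for. The induction needs a
  convexity that subpolygons inherit. Points of intersection with nearby hyperplanes are awkward for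
  this, since points of different edges may coincide and then count once. Sign patterns along the
  lift count edges instead; the passage to them happens once, with a generic hyperplane. The edge
  that replaces the two edges at a deleted vertex joins the neighbours in the lift, so
  \<open>l\<close> is the same throughout the induction. The bound \<open>d + 1\<close> is the
  number of all consecutive pairs in a period of the simplex.\<close>

definition lin_indep_on :: "('i \<Rightarrow> 'a::real_vector) \<Rightarrow> 'i set \<Rightarrow> bool" where
  "lin_indep_on v J \<longleftrightarrow> (\<forall>c. (\<Sum>j\<in>J. c j *\<^sub>R v j) = 0 \<longrightarrow> (\<forall>j\<in>J. c j = 0))"

lemma lin_indep_onD:
  "lin_indep_on v J \<Longrightarrow> (\<Sum>j\<in>J. c j *\<^sub>R v j) = 0 \<Longrightarrow> j \<in> J \<Longrightarrow> c j = 0"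
  unfolding lin_indep_on_def by blast

lemma lin_indep_on_iff:
  fixes v :: "'i \<Rightarrow> 'a::euclidean_space"
  assumes "finite J"
  shows "lin_indep_on v J \<longleftrightarrow> inj_on v J \<and> independent (v ` J)"
proof
  assume L: "lin_indep_on v J"
  have inj: "inj_on v J"
  proof (rule inj_onI, rule ccontr)
    fix i j assume ij: "i \<in> J" "j \<in> J" "v i = v j" "i \<noteq> j"
    define c where "c k = (if k = i then 1 else if k = j then - 1 else 0 :: real)" for k
    have "(\<Sum>k\<in>J. c k *\<^sub>R v k) = (\<Sum>k\<in>{i, j}. c k *\<^sub>R v k)"
      by (rule sum.mono_neutral_right) (use ij assms in \<open>auto simp: c_def\<close>)
    also have "\<dots> = 0"
      using ij by (simp add: c_def)
    finally have "c i = 0"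
      using lin_indep_onD[OF L] ij(1) by blast
    then show False
      by (simp add: c_def)
  qed
  moreover have "independent (v ` J)"
    unfolding independent_explicit
  proof (intro conjI allI impI ballI)
    show "finite (v ` J)"
      using assms by simp
  next
    fix c w assume c: "(\<Sum>w\<in>v ` J. c w *\<^sub>R w) = 0" and "w \<in> v ` J"
    then obtain j where j: "j \<in> J" "w = v j"
      by blast
    have "(\<Sum>j\<in>J. c (v j) *\<^sub>R v j) = 0"
      using c by (simp add: sum.reindex[OF inj])
    then show "c w = 0"
      using lin_indep_onD[OF L, of "\<lambda>j. c (v j)"] j by simp
  qed
  ultimately show "inj_on v J \<and> independent (v ` J)"
    by blast
next
  assume R: "inj_on v J \<and> independent (v ` J)"
  show "lin_indep_on v J"
    unfolding lin_indep_on_def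
  proof (intro allI impI ballI)
    fix c j assume c: "(\<Sum>j\<in>J. c j *\<^sub>R v j) = 0" and j: "j \<in> J"
    let ?g = "inv_into J v"
    have "(\<Sum>w\<in>v ` J. c (?g w) *\<^sub>R w) = (\<Sum>j\<in>J. c j *\<^sub>R v j)"
      using R by (subst sum.reindex) (auto intro!: sum.cong simp: inv_into_f_f)
    then have "c (?g (v j)) = 0"
      using conjunct2[OF R, unfolded independent_explicit, THEN conjunct2, rule_format, of "\<lambda>w. c (?g w)"]
        c j by simp
    then show "c j = 0"
      using R j by (simp add: inv_into_f_f)
  qed
qed

lemma lin_indep_on_subset:
  fixes v :: "'i \<Rightarrow> 'a::euclidean_space"
  assumes "lin_indep_on v J" "finite J" "I \<subseteq> J"
  shows "lin_indep_on v I"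
  using assms(1) inj_on_subset[OF _ assms(3), of v] independent_mono[OF _ image_mono[OF assms(3)], of v]
  by (simp add: lin_indep_on_iff assms(2) finite_subset[OF assms(3,2)])

lemma lin_indep_on_card_le:
  fixes v :: "'i \<Rightarrow> 'a::euclidean_space"
  assumes "lin_indep_on v J" "finite J"
  shows "card J \<le> DIM('a)"
proof -
  have "inj_on v J" "independent (v ` J)"
    using assms by (simp_all add: lin_indep_on_iff)
  then show ?thesis
    using independent_bound[of "v ` J"] by (simp add: card_image)
qed

lemma lin_indep_on_orthogonal_eq_0:
  fixes v :: "'i \<Rightarrow> 'a::euclidean_space"
  assumes "lin_indep_on v J" "finite J" "card J = DIM('a)" "\<And>j. j \<in> J \<Longrightarrow> f \<bullet> v j = 0"
  shows "f = 0"
proof -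
  have ind: "independent (v ` J)" "card (v ` J) = DIM('a)"
    using assms(1-3) by (simp_all add: lin_indep_on_iff card_image)
  have "UNIV \<subseteq> span (v ` J)"
    using ind assms(2) by (intro card_ge_dim_independent) auto
  then have "span (v ` J) = UNIV"
    by blast
  moreover have "f \<bullet> x = 0" if "x \<in> span (v ` J)" for x
    using that by (induction rule: span_induct_alt) (auto simp: assms(4) inner_add_right)
  ultimately show ?thesis
    using inner_eq_zero_iff[of f] by blast
qed

lemma lin_indep_on_interpolation:
  fixes v :: "'i \<Rightarrow> 'a::euclidean_space" and a :: "'i \<Rightarrow> real"
  assumes "lin_indep_on v J" "finite J"
  obtains u where "\<And>j. j \<in> J \<Longrightarrow> u \<bullet> v j = a j"
proof -
  have J: "inj_on v J" "independent (v ` J)"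
    using assms by (auto simp: lin_indep_on_iff)
  obtain g :: "'a \<Rightarrow> real" where g: "linear g" "\<And>x. x \<in> v ` J \<Longrightarrow> g x = a (inv_into J v x)"
    using linear_independent_extend[OF J(2), of "\<lambda>x. a (inv_into J v x)"] by blast
  show thesis
  proof
    \<comment> \<open>\<open>adjoint g 1\<close> is the vector that represents the functional
      \<open>g\<close>: its inner product with \<open>x\<close> is \<open>g x\<close>.\<close>
    show "adjoint g 1 \<bullet> v j = a j" if "j \<in> J" for j
      using adjoint_works[OF g(1), of "v j" 1] g(2)[of "v j"] that J(1)
      by (simp add: inner_commute)
  qed
qed

subsection \<open>Determinants of finite sequences of vectors\<close>

text \<open>Rows are indexed by the unordered type \<open>'n\<close>, so an enumeration has to be
  chosen. Another one would change all determinants by a common sign, which no product of two of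
  them sees.\<close>

definition row_index :: "'n::finite \<Rightarrow> nat" where
  "row_index = (SOME b. bij_betw b UNIV {..<CARD('n)})"

lemma bij_betw_row_index: "bij_betw (row_index :: 'n::finite \<Rightarrow> nat) UNIV {..<CARD('n)}"
  unfolding row_index_def
  using someI_ex[OF ex_bij_betw_finite_nat[OF finite[of "UNIV :: 'n set"]]]
  by (simp add: atLeast0LessThan)

lemma row_index_less: "row_index (r :: 'n::finite) < CARD('n)"
  using bij_betw_apply[OF bij_betw_row_index, of r] by simp

lemma row_index_eq_iff [simp]: "row_index (r :: 'n::finite) = row_index s \<longleftrightarrow> r = s"
  using bij_betw_imp_inj_on[OF bij_betw_row_index[where 'n = 'n]] by (simp add: inj_eq)

lemma row_index_surj:
  assumes "k < CARD('n::finite)"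
  obtains r :: "'n::finite" where "row_index r = k"
proof -
  have "k \<in> range (row_index :: 'n \<Rightarrow> nat)"
    using bij_betw_imp_surj_on[OF bij_betw_row_index[where 'n = 'n]] assms by simp
  then show thesis
    using that by blast
qed

definition seq_det :: "(nat \<Rightarrow> real ^ 'n::finite) \<Rightarrow> real" where
  "seq_det x = det (\<chi> r. x (row_index r))"

lemma seq_det_cong:
  fixes x y :: "nat \<Rightarrow> real ^ 'n::finite"
  assumes "\<And>k. k < CARD('n) \<Longrightarrow> x k = y k"
  shows "seq_det x = seq_det y"
  unfolding seq_det_def by (simp add: assms row_index_less)

lemma linear_seq_det:
  fixes x :: "nat \<Rightarrow> real ^ 'n::finite"
  assumes "k < CARD('n)"
  shows "linear (\<lambda>w. seq_det (x(k := w)))"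
proof -
  obtain r0 :: 'n where r0: "row_index r0 = k"
    using row_index_surj[OF assms] by blast
  have eq: "seq_det (x(k := w)) = det (\<chi> r. if r = r0 then w else x (row_index r))" for w
    unfolding seq_det_def
    by (rule arg_cong[where f = det]) (use r0 in \<open>auto simp: vec_eq_iff fun_upd_def\<close>)
  show ?thesis
    unfolding eq
  proof (rule linearI)
    fix a b :: "real ^ 'n" and c :: real
    show "det (\<chi> r. if r = r0 then a + b else x (row_index r)) =
      det (\<chi> r. if r = r0 then a else x (row_index r)) + det (\<chi> r. if r = r0 then b else x (row_index r))"
      using det_row_add[of r0 "\<lambda>_. a" "\<lambda>_. b" "\<lambda>r. x (row_index r)"] .
    show "det (\<chi> r. if r = r0 then c *\<^sub>R a else x (row_index r)) =
      c *\<^sub>R det (\<chi> r. if r = r0 then a else x (row_index r))"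
      using det_row_mul[of r0 c "\<lambda>_. a" "\<lambda>r. x (row_index r)"]
      unfolding scalar_mult_eq_scaleR real_scaleR_def .
  qed
qed

lemma seq_det_eq_0:
  fixes x :: "nat \<Rightarrow> real ^ 'n::finite"
  assumes "i \<noteq> j" "x i = x j" "i < CARD('n)" "j < CARD('n)"
  shows "seq_det x = 0"
proof -
  obtain r s :: 'n where "row_index r = i" "row_index s = j"
    using row_index_surj[OF assms(3)] row_index_surj[OF assms(4)] by metis
  then show ?thesis
    unfolding seq_det_def using assms
    by (intro det_identical_rows[of r s]) (auto simp: row_def vec_eq_iff)
qed

text \<open>An alternating bilinear form is antisymmetric: expand it with \<open>x i + x j\<close>
  in both slots.\<close>

lemma seq_det_swap:
  fixes x :: "nat \<Rightarrow> real ^ 'n::finite"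
  assumes ij: "i \<noteq> j" "i < CARD('n)" "j < CARD('n)"
  shows "seq_det (x(i := x j, j := x i)) = - seq_det x"
proof -
  let ?D = "\<lambda>a b. seq_det (x(i := a, j := b))"
  interpret L: linear "\<lambda>b. ?D a b" for a
    using linear_seq_det[OF ij(3), of "x(i := a)"] .
  have R: "linear (\<lambda>a. ?D a b)" for b
    using linear_seq_det[OF ij(2), of "x(j := b)"] ij(1) by (simp add: fun_upd_twist)
  interpret R: linear "\<lambda>a. ?D a b" for b
    by (rule R)
  have diag: "?D a a = 0" for a
    using seq_det_eq_0[OF ij(1) _ ij(2,3)] ij(1) by simp
  have "?D (x i + x j) (x i + x j) = ?D (x i + x j) (x i) + ?D (x i + x j) (x j)"
    by (rule L.add)
  moreover have "?D (x i + x j) b = ?D (x i) b + ?D (x j) b" for b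
    by (rule R.add)
  moreover have "?D (x i) (x j) = seq_det x"
    by simp
  ultimately show ?thesis
    by (simp only: diag)
qed

lemma seq_det_nonzero:
  fixes x :: "nat \<Rightarrow> real ^ 'n::finite"
  assumes "lin_indep_on x {..<CARD('n)}"
  shows "seq_det x \<noteq> 0"
proof -
  let ?A = "(\<chi> r. x (row_index r)) :: real ^ 'n ^ 'n"
  have "\<exists>B. ?A ** B = mat 1"
    unfolding matrix_right_invertible_independent_rows
  proof (intro allI impI)
    fix c :: "'n \<Rightarrow> real" and r :: 'n
    assume 0: "(\<Sum>r\<in>UNIV. c r *s row r ?A) = 0"
    let ?g = "inv_into UNIV row_index :: nat \<Rightarrow> 'n"
    have g: "?g (row_index r) = r" for r
      using bij_betw_imp_inj_on[OF bij_betw_row_index[where 'n = 'n]] by (rule inv_into_f_f) simp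
    have "(\<Sum>k<CARD('n). c (?g k) *\<^sub>R x k) = (\<Sum>r\<in>UNIV. c r *\<^sub>R x (row_index r))"
      using sum.reindex_bij_betw[OF bij_betw_row_index[where 'n = 'n], of "\<lambda>k. c (?g k) *\<^sub>R x k"]
      unfolding g by (rule sym)
    also have "\<dots> = 0"
      using 0 by (simp add: row_def scalar_mult_eq_scaleR vec_nth_inverse)
    finally have "c (?g (row_index r)) = 0"
      by (rule lin_indep_onD[OF assms]) (simp add: row_index_less)
    then show "c r = 0"
      unfolding g .
  qed
  then have "invertible ?A"
    by (metis invertible_def matrix_left_right_inverse)
  then show ?thesis
    unfolding seq_det_def by (simp add: invertible_det_nz)
qed

text \<open>The first vector travels to position \<open>m\<close> by adjacent swaps, one in each
  step of the induction. This sign is how the parity of \<open>d\<close> enters, both for the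
  simplex and for flattenings.\<close>

lemma seq_det_rotate:
  fixes x :: "nat \<Rightarrow> real ^ 'n::finite"
  assumes "m < CARD('n)"
  shows "seq_det (\<lambda>k. if k < m then x (Suc k) else if k = m then x 0 else x k) = (-1) ^ m * seq_det x"
  using assms
proof (induction m)
  case 0
  have "(\<lambda>k. if k < 0 then x (Suc k) else if k = 0 then x 0 else x k) = x"
    by auto
  then show ?case by simp
next
  case (Suc m)
  let ?z = "\<lambda>k. if k < m then x (Suc k) else if k = m then x 0 else x k"
  have "(\<lambda>k. if k < Suc m then x (Suc k) else if k = Suc m then x 0 else x k)
      = ?z(m := ?z (Suc m), Suc m := ?z m)"
    by (auto simp: fun_eq_iff)
  then show ?case
    using seq_det_swap[of m "Suc m" ?z] Suc by simp
qed

definition skip :: "nat \<Rightarrow> (nat \<Rightarrow> 'a) \<Rightarrow> nat \<Rightarrow> 'a" where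
  "skip m x k = (if k < m then x k else x (Suc k))"

text \<open>Insert the relation itself into slot \<open>m\<close> of the determinant of
  \<open>skip m x\<close>. Every vector other than \<open>x m\<close> and \<open>x (Suc m)\<close>
  then occurs twice, so only two terms survive.\<close>

lemma seq_det_skip_Suc:
  fixes x :: "nat \<Rightarrow> real ^ 'n::finite"
  assumes m: "m < CARD('n)" and c: "(\<Sum>k\<le>CARD('n). c k *\<^sub>R x k) = 0"
  shows "c m * seq_det (skip (Suc m) x) = - c (Suc m) * seq_det (skip m x)"
proof -
  let ?L = "\<lambda>w. seq_det ((skip m x)(m := w))"
  interpret L: linear ?L
    by (rule linear_seq_det[OF m])
  have zero: "?L (x k) = 0" if "k \<le> CARD('n)" "k \<notin> {m, Suc m}" for k
  proof (cases "k < m")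
    case True
    then show ?thesis
      using m by (intro seq_det_eq_0[of k m]) (auto simp: skip_def)
  next
    case False
    then show ?thesis
      using m that by (intro seq_det_eq_0[of "k - 1" m]) (auto simp: skip_def)
  qed
  have "0 = ?L (\<Sum>k\<le>CARD('n). c k *\<^sub>R x k)"
    using c L.zero by simp
  also have "\<dots> = (\<Sum>k\<le>CARD('n). c k * ?L (x k))"
    by (simp only: L.sum L.scale real_scaleR_def)
  also have "\<dots> = (\<Sum>k\<in>{m, Suc m}. c k * ?L (x k))"
    using m by (intro sum.mono_neutral_right) (auto simp: zero)
  also have "\<dots> = c m * ?L (x m) + c (Suc m) * ?L (x (Suc m))"
    by simp
  also have "(skip m x)(m := x m) = skip (Suc m) x"
    by (auto simp: skip_def fun_eq_iff less_Suc_eq)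
  also have "(skip m x)(m := x (Suc m)) = skip m x"
    by (auto simp: skip_def fun_eq_iff)
  finally show ?thesis
    by simp
qed

text \<open>Cramer's rule. Some nontrivial relation \<open>c\<close> exists for reasons of
  dimension; by independence none of its coefficients vanishes, and comparing neighbouring
  coefficients with \<open>seq_det_skip_Suc\<close> shows that the signed minors are proportional to
  \<open>c\<close>.\<close>

lemma seq_det_skip_relation:
  fixes x :: "nat \<Rightarrow> real ^ 'n::finite"
  assumes indep: "\<And>m. m \<le> CARD('n) \<Longrightarrow> lin_indep_on x ({..CARD('n)} - {m})"
  shows "(\<Sum>k\<le>CARD('n). ((-1) ^ k * seq_det (skip k x)) *\<^sub>R x k) = 0"
proof -
  have "\<not> lin_indep_on x {..CARD('n)}"
    using lin_indep_on_card_le[of x "{..CARD('n)}"] by auto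
  then obtain c k0 where c: "(\<Sum>k\<le>CARD('n). c k *\<^sub>R x k) = 0" and k0: "k0 \<le> CARD('n)" "c k0 \<noteq> 0"
    unfolding lin_indep_on_def by auto
  have nz: "c m \<noteq> 0" if "m \<le> CARD('n)" for m
  proof
    assume m: "c m = 0"
    have "(\<Sum>k\<in>{..CARD('n)} - {m}. c k *\<^sub>R x k) = (\<Sum>k\<le>CARD('n). c k *\<^sub>R x k)"
      using m that by (intro sum.mono_neutral_left) auto
    then have "c k0 = 0"
      using lin_indep_onD[OF indep[OF that]] c k0 m by (cases "k0 = m") auto
    then show False
      using k0 by simp
  qed
  have D: "c 0 * seq_det (skip m x) = (-1) ^ m * c m * seq_det (skip 0 x)" if "m \<le> CARD('n)" for m
    using that
  proof (induction m)
    case (Suc m)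
    have "c m * (c 0 * seq_det (skip (Suc m) x)) = c 0 * (- c (Suc m) * seq_det (skip m x))"
      using seq_det_skip_Suc[of m c x] Suc.prems c by (simp add: algebra_simps)
    also have "\<dots> = - c (Suc m) * ((-1) ^ m * c m * seq_det (skip 0 x))"
      using Suc by simp
    also have "\<dots> = c m * ((-1) ^ Suc m * c (Suc m) * seq_det (skip 0 x))"
      by simp
    finally show ?case
      using nz[of m] Suc.prems by (metis Suc_leD mult_left_cancel)
  qed simp
  have "c 0 *\<^sub>R (\<Sum>k\<le>CARD('n). ((-1) ^ k * seq_det (skip k x)) *\<^sub>R x k)
      = (\<Sum>k\<le>CARD('n). ((-1) ^ k * (c 0 * seq_det (skip k x))) *\<^sub>R x k)"
    by (simp add: scaleR_sum_right mult_ac)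
  also have "\<dots> = (\<Sum>k\<le>CARD('n). seq_det (skip 0 x) *\<^sub>R c k *\<^sub>R x k)"
    by (rule sum.cong) (auto simp: D mult_ac)
  also have "\<dots> = 0"
    by (subst scaleR_sum_right[symmetric]) (simp add: c)
  finally show ?thesis
    using nz[of 0] by simp
qed

subsection \<open>Quasi-periodic sequences and their sign changes\<close>

text \<open>Going around the polygon once need not close the lift: for \<open>l < 0\<close> it ends
  on the ray opposite to its start. Determinants and sign sequences inherit the same kind of
  twist.\<close>

definition quasi_periodic :: "nat \<Rightarrow> real \<Rightarrow> (int \<Rightarrow> 'a::real_vector) \<Rightarrow> bool" where
  "quasi_periodic n l v \<longleftrightarrow> (\<forall>i. v (i + int n) = l *\<^sub>R v i)"

lemma quasi_periodicD: "quasi_periodic n l v \<Longrightarrow> v (i + int n) = l *\<^sub>R v i"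
  by (simp add: quasi_periodic_def)

lemma quasi_periodic_shift:
  assumes "quasi_periodic n l v" "l \<noteq> 0"
  shows "v (i + k * int n) = (l powi k) *\<^sub>R v i"
proof (induction k rule: int_induct[where k = 0])
  case base
  show ?case by simp
next
  case (step1 k)
  have "v (i + (k + 1) * int n) = l *\<^sub>R v (i + k * int n)"
    using quasi_periodicD[OF assms(1), of "i + k * int n"] by (simp add: algebra_simps)
  then show ?case
    using step1 assms(2) by (simp add: power_int_add mult.commute)
next
  case (step2 k)
  have "v (i + k * int n) = l *\<^sub>R v (i + (k - 1) * int n)"
    using quasi_periodicD[OF assms(1), of "i + (k - 1) * int n"] by (simp add: algebra_simps)
  then have "v (i + (k - 1) * int n) = inverse l *\<^sub>R v (i + k * int n)"
    using assms(2) by simp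
  then show ?case
    using step2 assms(2) by (simp add: power_int_diff divide_inverse mult.commute)
qed

lemma quasi_periodic_mod:
  assumes "quasi_periodic n l v" "l \<noteq> 0"
  shows "v i = (l powi (i div int n)) *\<^sub>R v (i mod int n)"
  using quasi_periodic_shift[OF assms, of "i mod int n" "i div int n"] by simp

lemma quasi_periodic_powi_extension:
  assumes "n > 0" "l \<noteq> 0"
  shows "quasi_periodic n l (\<lambda>i. (l powi ((i - j) div int n)) *\<^sub>R p (j + (i - j) mod int n))"
proof -
  have "(i + int n - j) div int n = (i - j) div int n + 1" "(i + int n - j) mod int n = (i - j) mod int n" for i
    using div_add_self2[of "int n" "i - j"] mod_add_self2[of "i - j" "int n"] assms(1)
    by (simp_all add: algebra_simps)
  then show ?thesis
    using assms by (simp add: quasi_periodic_def power_int_add mult.commute)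
qed

lemma quasi_periodic_extension:
  fixes p :: "int \<Rightarrow> real"
  assumes "n > 0" "l \<noteq> 0" "\<And>i. i \<in> {j..<j + int n} \<Longrightarrow> p i \<noteq> 0"
  obtains s where "quasi_periodic n l s" "\<And>i. s i \<noteq> 0" "\<And>i. i \<in> {j..<j + int n} \<Longrightarrow> s i = p i"
proof
  let ?s = "\<lambda>i. (l powi ((i - j) div int n)) *\<^sub>R p (j + (i - j) mod int n)"
  show "quasi_periodic n l ?s"
    by (rule quasi_periodic_powi_extension[OF assms(1,2)])
  show "?s i \<noteq> 0" for i
    using assms by simp
  show "?s i = p i" if "i \<in> {j..<j + int n}" for i
    using that by (simp add: div_pos_pos_trivial mod_pos_pos_trivial)
qed

text \<open>Both factors pick up the same power of \<open>l\<close>, hence the product a positive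
  square, even if \<open>l\<close> is negative.\<close>

lemma quasi_periodic_same_sign:
  fixes s t :: "int \<Rightarrow> real"
  assumes "quasi_periodic n l s" "quasi_periodic n l t" "l \<noteq> 0"
  shows "s (i + k * int n) * t (i + k * int n) > 0 \<longleftrightarrow> s i * t i > 0"
    and "s (i + k * int n) * t (i + k * int n) < 0 \<longleftrightarrow> s i * t i < 0"
proof -
  have "s (i + k * int n) * t (i + k * int n) = (l powi k)\<^sup>2 * (s i * t i)"
    using assms by (simp add: quasi_periodic_shift power2_eq_square mult_ac)
  moreover have "(l powi k)\<^sup>2 > 0"
    using assms(3) by simp
  ultimately show "s (i + k * int n) * t (i + k * int n) > 0 \<longleftrightarrow> s i * t i > 0"
    "s (i + k * int n) * t (i + k * int n) < 0 \<longleftrightarrow> s i * t i < 0"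
    by (simp_all add: zero_less_mult_iff mult_less_0_iff)
qed

lemma shift_into_window:
  fixes i j :: int
  assumes "n > 0"
  obtains k where "i + k * int n \<in> {j..<j + int n}"
proof
  have "i + - ((i - j) div int n) * int n = j + (i - j) mod int n"
    by (simp add: minus_div_mult_eq_mod[symmetric])
  then show "i + - ((i - j) div int n) * int n \<in> {j..<j + int n}"
    using assms by simp
qed

lemma quasi_periodic_same_sign_all:
  fixes s t :: "int \<Rightarrow> real"
  assumes "quasi_periodic n l s" "quasi_periodic n l t" "l \<noteq> 0" "n > 0"
    and "\<And>i. i \<in> {j..<j + int n} \<Longrightarrow> t i \<noteq> 0 \<Longrightarrow> s i * t i > 0" "t i \<noteq> 0"
  shows "s i * t i > 0"
proof -
  obtain k where k: "i + k * int n \<in> {j..<j + int n}"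
    using shift_into_window[OF assms(4)] .
  have "t (i + k * int n) \<noteq> 0"
    using assms by (simp add: quasi_periodic_shift)
  then show ?thesis
    using assms(5)[OF k] quasi_periodic_same_sign(1)[OF assms(1-3)] by simp
qed

lemma inj_on_mod_window:
  "inj_on (\<lambda>i. i mod int n) {j..<j + int n}"
proof (rule inj_onI)
  fix x y assume "x \<in> {j..<j + int n}" "y \<in> {j..<j + int n}" and eq: "x mod int n = y mod int n"
  then have "\<bar>x - y\<bar> < int n"
    by auto
  moreover have "int n dvd x - y"
    using eq by (simp add: mod_eq_dvd_iff)
  ultimately show "x = y"
    using zdvd_imp_le[of "int n" "\<bar>x - y\<bar>"] by (cases "x = y") auto
qed

lemma mod_image_window: "n > 0 \<Longrightarrow> (\<lambda>i. i mod int n) ` {j..<j + int n} = {0..<int n}"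
  by (rule card_subset_eq) (auto simp: card_image[OF inj_on_mod_window])

lemma card_periodic_window:
  assumes per: "\<And>i. P (i + int n) \<longleftrightarrow> P i" and "n > 0"
  shows "card {i \<in> {j..<j + int n}. P i} = card {i \<in> {0..<int n}. P i}"
proof -
  have shift: "P (i + k * int n) \<longleftrightarrow> P i" for i k
  proof (induction k rule: int_induct[where k = 0])
    case (step1 k)
    then show ?case using per[of "i + k * int n"] by (simp add: algebra_simps)
  next
    case (step2 k)
    then show ?case using per[of "i + (k - 1) * int n"] by (simp add: algebra_simps)
  qed simp
  have P: "P (i mod int n) \<longleftrightarrow> P i" for i
    using shift[of "i mod int n" "i div int n"] by simp
  have "{i \<in> {0..<int n}. P i} = (\<lambda>i. i mod int n) ` {i \<in> {j..<j + int n}. P i}"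
    unfolding mod_image_window[OF \<open>n > 0\<close>, of j, symmetric] using P by auto
  then show ?thesis
    by (metis (no_types, lifting) card_image inj_on_mod_window inj_on_subset mem_Collect_eq subsetI)
qed

text \<open>The pair \<open>n - 1\<close>, \<open>n\<close> closes the cycle. For a quasi-periodic
  \<open>s\<close> it compares \<open>s (n - 1)\<close> with \<open>l * s 0\<close>, so the cycle is
  twisted if \<open>l < 0\<close>.\<close>

definition sign_changes :: "nat \<Rightarrow> (int \<Rightarrow> real) \<Rightarrow> nat" where
  "sign_changes n s = card {i \<in> {0..<int n}. s i * s (i + 1) < 0}"

lemma sign_changes_window:
  assumes "quasi_periodic n l s" "l \<noteq> 0" "n > 0"
  shows "sign_changes n s = card {i \<in> {j..<j + int n}. s i * s (i + 1) < 0}"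
proof -
  have "s (i + int n) * s (i + int n + 1) < 0 \<longleftrightarrow> s i * s (i + 1) < 0" for i
  proof -
    have "quasi_periodic n l (\<lambda>i. s (i + 1))"
      using quasi_periodicD[OF assms(1), of "i + 1" for i] by (simp add: quasi_periodic_def algebra_simps)
    then show ?thesis
      using quasi_periodic_same_sign(2)[OF assms(1) _ assms(2), of "\<lambda>i. s (i + 1)" i 1] by simp
  qed
  then show ?thesis
    unfolding sign_changes_def using card_periodic_window[of "\<lambda>i. s i * s (i + 1) < 0" n j] assms(3) by simp
qed

lemma sign_changes_eq_card_nat:
  "sign_changes n s = card {i \<in> {..<n}. s (int i) * s (int i + 1) < 0}"
proof -
  have "{i \<in> {0..<int n}. s i * s (i + 1) < 0} = int ` {i \<in> {..<n}. s (int i) * s (int i + 1) < 0}"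
    by (auto simp: image_iff) (metis nat_0_le nat_less_iff)
  then show ?thesis
    unfolding sign_changes_def by (simp add: card_image)
qed

lemma sign_changes_eq_sum:
  "sign_changes n s = (\<Sum>i<n. of_bool (s (int i) * s (int i + 1) < 0))"
  unfolding sign_changes_eq_card_nat by (simp add: sum.If_cases of_bool_def Int_def)

text \<open>The interlaced sequence \<open>a 0, b 0, a 1, b 1, \<dots>, b n, a (n + 1)\<close> has as many sign changes
  as \<open>a\<close>.\<close>

lemma sign_changes_interlacing:
  fixes a b :: "int \<Rightarrow> real"
  assumes "\<And>i. i \<in> {0..int n} \<Longrightarrow> b i * a i > 0 \<or> b i * a (i + 1) > 0"
    and "\<And>i. a i \<noteq> 0"
  shows "sign_changes n b \<le> sign_changes (Suc n) a"
proof -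
  \<comment> \<open>The induction carries an extra summand: the sign change still pending between
    \<open>b k\<close> and \<open>a (k + 1)\<close>, from which the next change of \<open>b\<close>
    is paid.\<close>
  have "(\<Sum>i<k. of_bool (b (int i) * b (int i + 1) < 0)) + of_bool (b (int k) * a (int k + 1) < 0)
      \<le> (\<Sum>i<Suc k. of_bool (a (int i) * a (int i + 1) < 0) :: nat)" if "k \<le> n" for k
    using that
  proof (induction k)
    case 0
    then show ?case
      using assms(1)[of 0] by (auto simp: zero_less_mult_iff mult_less_0_iff)
  next
    case (Suc k)
    let ?k = "int k"
    have k: "b ?k * a ?k > 0 \<or> b ?k * a (?k + 1) > 0"
      "b (?k + 1) * a (?k + 1) > 0 \<or> b (?k + 1) * a (?k + 2) > 0"
      using assms(1)[of ?k] assms(1)[of "?k + 1"] Suc.prems by (auto simp: add.commute)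
    have "of_bool (b ?k * b (?k + 1) < 0) + of_bool (b (?k + 1) * a (?k + 2) < 0)
       \<le> of_bool (b ?k * a (?k + 1) < 0) + (of_bool (a (?k + 1) * a (?k + 2) < 0) :: nat)"
      using k assms(2)[of "?k + 1"] assms(2)[of "?k + 2"]
      by (auto simp: zero_less_mult_iff mult_less_0_iff of_bool_def split: if_splits)
    moreover have "int (Suc k) = ?k + 1" "?k + 1 + 1 = ?k + 2"
      by simp_all
    ultimately show ?case
      using Suc.IH Suc.prems by (simp only: sum.lessThan_Suc) linarith
  qed
  from this[of n] show ?thesis
    unfolding sign_changes_eq_sum by linarith
qed

subsection \<open>Convexity of quasi-periodic families of vectors\<close>

definition general_family :: "nat \<Rightarrow> (int \<Rightarrow> real ^ 'n::finite) \<Rightarrow> bool" where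
  "general_family n v \<longleftrightarrow> (\<forall>J \<subseteq> {0..<int n}. card J = CARD('n) \<longrightarrow> lin_indep_on v J)"

text \<open>The sequences \<open>s\<close> record the possible signs of \<open>g \<bullet> v i\<close> for functionals \<open>g\<close> close to \<open>f\<close> that vanish
  on no \<open>v i\<close>: where \<open>f\<close> vanishes, the sign can be chosen freely. In contrast to nearby
  hyperplanes, this notion passes to subpolygons at once.\<close>

definition convex_support ::
    "nat \<Rightarrow> nat \<Rightarrow> real \<Rightarrow> (int \<Rightarrow> real ^ 'n::finite) \<Rightarrow> real ^ 'n \<Rightarrow> bool" where
  "convex_support d n l v f \<longleftrightarrow> f \<noteq> 0 \<and>
     (\<forall>s. quasi_periodic n l s \<longrightarrow> (\<forall>i. s i \<noteq> 0) \<longrightarrow> (\<forall>i. f \<bullet> v i \<noteq> 0 \<longrightarrow> s i * (f \<bullet> v i) > 0) \<longrightarrow>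
        sign_changes n s \<le> d - 1)"

definition convex_family :: "nat \<Rightarrow> nat \<Rightarrow> real \<Rightarrow> (int \<Rightarrow> real ^ 'n::finite) \<Rightarrow> bool" where
  "convex_family d n l v \<longleftrightarrow>
     (\<forall>I \<subseteq> {0..<int n}. card I = d - 1 \<longrightarrow> (\<exists>f. convex_support d n l v f \<and> (\<forall>i\<in>I. f \<bullet> v i = 0)))"

lemma quasi_periodic_inner:
  "quasi_periodic n l v \<Longrightarrow> quasi_periodic n l (\<lambda>i. f \<bullet> v i)"
  by (simp add: quasi_periodic_def)

text \<open>Reducing the indices modulo \<open>n\<close> only rescales the vectors by powers of
  \<open>l\<close>, and the residues can be completed to a set of maximal size within one
  period.\<close>

lemma general_family_lin_indep_on:
  fixes v :: "int \<Rightarrow> real ^ 'n::finite"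
  assumes gen: "general_family n v" and n: "CARD('n) \<le> n" and qp: "quasi_periodic n l v" "l \<noteq> 0"
    and J: "finite J" "inj_on (\<lambda>i. i mod int n) J" "card J \<le> CARD('n)"
  shows "lin_indep_on v J"
proof -
  let ?m = "\<lambda>i. i mod int n"
  have "n > 0"
    using n by (metis card_eq_0_iff finite_UNIV_card_ge_0 finite le_zero_eq not_gr_zero)
  then have "?m ` J \<subseteq> {0..<int n}"
    by auto
  then obtain K where K: "?m ` J \<subseteq> K" "K \<subseteq> {0..<int n}" "card K = CARD('n)"
    using exists_subset_between[of "?m ` J" "CARD('n)" "{0..<int n}"] J n by (auto simp: card_image)
  then have "lin_indep_on v K"
    using gen unfolding general_family_def by blast
  then have *: "lin_indep_on v (?m ` J)"
    using K by (meson finite_atLeastLessThan_int finite_subset lin_indep_on_subset)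
  show ?thesis
    unfolding lin_indep_on_def
  proof (intro allI impI ballI)
    fix c j assume c: "(\<Sum>j\<in>J. c j *\<^sub>R v j) = 0" and j: "j \<in> J"
    let ?g = "inv_into J ?m"
    define c' where "c' r = c (?g r) * l powi (?g r div int n)" for r
    have "(\<Sum>r\<in>?m ` J. c' r *\<^sub>R v r) = (\<Sum>j\<in>J. c' (?m j) *\<^sub>R v (?m j))"
      by (simp add: sum.reindex[OF J(2)])
    also have "\<dots> = (\<Sum>j\<in>J. c j *\<^sub>R v j)"
    proof (rule sum.cong)
      fix j assume "j \<in> J"
      then have "c' (?m j) = c j * l powi (j div int n)"
        by (simp add: c'_def inv_into_f_f[OF J(2)])
      then show "c' (?m j) *\<^sub>R v (?m j) = c j *\<^sub>R v j"
        using quasi_periodic_mod[OF qp, of j] by simp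
    qed simp
    finally have "c' (?m j) = 0"
      using lin_indep_onD[OF *] c j by simp
    then show "c j = 0"
      using qp(2) j by (simp add: c'_def inv_into_f_f[OF J(2)])
  qed
qed

lemma general_family_window:
  fixes v :: "int \<Rightarrow> real ^ 'n::finite"
  assumes "general_family n v" "CARD('n) \<le> n" "quasi_periodic n l v" "l \<noteq> 0"
    and S: "S \<subseteq> {..<n}" "card S \<le> CARD('n)"
  shows "lin_indep_on (\<lambda>k. v (i + int k)) S"
proof -
  let ?J = "(\<lambda>k. i + int k) ` S"
  have fin: "finite S"
    using S(1) finite_subset by blast
  have inj: "inj_on (\<lambda>k. i + int k) S"
    by (simp add: inj_on_def)
  have "?J \<subseteq> {i..<i + int n}"
    using S(1) by auto
  then have "inj_on (\<lambda>i. i mod int n) ?J"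
    using inj_on_mod_window inj_on_subset by blast
  then have "lin_indep_on v ?J"
    using fin S(2) by (intro general_family_lin_indep_on[OF assms(1-4)]) (simp_all add: card_image[OF inj])
  then have "inj_on v ?J" "independent (v ` ?J)"
    using fin by (auto simp: lin_indep_on_iff)
  then show ?thesis
    using comp_inj_on[OF inj, of v] fin by (simp add: lin_indep_on_iff image_image o_def)
qed

text \<open>Local test for a support: signs prescribed on \<open>K + 1\<close> consecutive vectors
  are completed to a period by the signs of \<open>f\<close>, or by 1 where \<open>f\<close>
  vanishes. The changes inside the window are among those of the whole period.\<close>

lemma convex_support_window_bound:
  fixes v :: "int \<Rightarrow> real ^ 'n::finite" and p :: "nat \<Rightarrow> real"
  assumes supp: "convex_support d n l v f" and qp: "quasi_periodic n l v" "l \<noteq> 0"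
    and K: "Suc K \<le> n" and p: "\<And>k. k \<le> K \<Longrightarrow> p k \<noteq> 0"
    and pf: "\<And>k. k \<le> K \<Longrightarrow> f \<bullet> v (j + int k) \<noteq> 0 \<Longrightarrow> p k * (f \<bullet> v (j + int k)) > 0"
  shows "card {k \<in> {..<K}. p k * p (Suc k) < 0} \<le> d - 1"
proof -
  define P where "P i = (if i \<le> j + int K then p (nat (i - j)) else if f \<bullet> v i \<noteq> 0 then f \<bullet> v i else 1)" for i
  have Pk: "P (j + int k) = p k" if "k \<le> K" for k
    using that by (simp add: P_def)
  have P0: "P i \<noteq> 0" if "i \<in> {j..<j + int n}" for i
    using that p by (auto simp: P_def)
  obtain s where s: "quasi_periodic n l s" "\<And>i. s i \<noteq> 0" "\<And>i. i \<in> {j..<j + int n} \<Longrightarrow> s i = P i"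
    using quasi_periodic_extension[of n l j P] K qp(2) P0 by auto
  have n: "n > 0"
    using K by simp
  have "s i * (f \<bullet> v i) > 0" if "f \<bullet> v i \<noteq> 0" for i
  proof (rule quasi_periodic_same_sign_all[OF s(1) quasi_periodic_inner[OF qp(1)] qp(2) n _ that])
    fix i assume i: "i \<in> {j..<j + int n}" "f \<bullet> v i \<noteq> 0"
    show "s i * (f \<bullet> v i) > 0"
    proof (cases "i \<le> j + int K")
      case True
      then have "i = j + int (nat (i - j))" "nat (i - j) \<le> K"
        using i by auto
      then show ?thesis
        using pf[of "nat (i - j)"] i s(3)[OF i(1)] Pk by metis
    next
      case False
      then show ?thesis
        using i s(3)[OF i(1)] by (auto simp: P_def zero_less_mult_iff)
    qed
  qed
  then have "sign_changes n s \<le> d - 1"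
    using supp s unfolding convex_support_def by blast
  moreover have "card {k \<in> {..<K}. p k * p (Suc k) < 0} \<le> card {i \<in> {j..<j + int n}. s i * s (i + 1) < 0}"
  proof (rule card_inj_on_le)
    show "inj_on (\<lambda>k. j + int k) {k \<in> {..<K}. p k * p (Suc k) < 0}"
      by (auto simp: inj_on_def)
    show "(\<lambda>k. j + int k) ` {k \<in> {..<K}. p k * p (Suc k) < 0} \<subseteq> {i \<in> {j..<j + int n}. s i * s (i + 1) < 0}"
    proof (rule image_subsetI)
      fix k assume "k \<in> {k \<in> {..<K}. p k * p (Suc k) < 0}"
      then have k: "k < K" "p k * p (Suc k) < 0"
        by simp_all
      have "s (j + int k) = p k" "s (j + int (Suc k)) = p (Suc k)"
        using k K s(3) Pk[of k] Pk[of "Suc k"] by auto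
      then show "j + int k \<in> {i \<in> {j..<j + int n}. s i * s (i + 1) < 0}"
        using k K by (simp add: algebra_simps)
    qed
  qed (rule finite_subset[of _ "{j..<j + int n}"]; auto)
  ultimately show ?thesis
    using sign_changes_window[OF s(1) qp(2) n, of j] by linarith
qed

section \<open>Determinants of consecutive vectors\<close>

definition window_det :: "(int \<Rightarrow> real ^ 'n::finite) \<Rightarrow> int \<Rightarrow> real" where
  "window_det v i = seq_det (\<lambda>k. v (i + int k))"

lemma window_det_nonzero:
  fixes v :: "int \<Rightarrow> real ^ 'n::finite"
  assumes "general_family n v" "CARD('n) \<le> n" "quasi_periodic n l v" "l \<noteq> 0"
  shows "window_det v i \<noteq> 0"
  unfolding window_det_def using assms(2)
  by (intro seq_det_nonzero general_family_window[OF assms]) auto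

lemma quasi_periodic_window_det:
  fixes v :: "int \<Rightarrow> real ^ 'n::finite"
  assumes "quasi_periodic n l v"
  shows "quasi_periodic n (l ^ CARD('n)) (window_det v)"
proof -
  have "window_det v (i + int n) = l ^ CARD('n) * window_det v i" for i
  proof -
    have "det (\<chi> r. l *s v (i + int (row_index r))) = (\<Prod>r\<in>(UNIV :: 'n set). l) * det (\<chi> r. v (i + int (row_index r)))"
      by (rule det_rows_mul)
    then have "seq_det (\<lambda>k. l *\<^sub>R v (i + int k)) = l ^ CARD('n) * seq_det (\<lambda>k. v (i + int k))"
      unfolding seq_det_def scalar_mult_eq_scaleR by simp
    moreover have "v (i + int n + int k) = l *\<^sub>R v (i + int k)" for k
      using quasi_periodicD[OF assms, of "i + int k"] by (simp add: algebra_simps)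
    ultimately show ?thesis
      by (simp add: window_det_def)
  qed
  then show ?thesis
    by (simp add: quasi_periodic_def)
qed

lemma alternating_mult_neg:
  fixes c :: real
  assumes "c \<noteq> 0"
  shows "(c * (-1) ^ k) * (c * (-1) ^ Suc k) < 0"
proof -
  have "(c * (-1) ^ k) * (c * (-1) ^ Suc k) = - (c\<^sup>2)"
    by (cases "even k") (auto simp: power2_eq_square)
  then show ?thesis
    using assms by simp
qed

text \<open>In the situation excluded here, a hyperplane through all vectors of the window but the first,
  the last and the \<open>m\<close>-th could be perturbed so as to separate \<open>d\<close> pairs of neighbours.\<close>

lemma convex_family_window:
  fixes v :: "int \<Rightarrow> real ^ 'n::finite"
  assumes CARD: "CARD('n) = d + 1" and n: "d + 2 \<le> n"
    and gen: "general_family n v" and qp: "quasi_periodic n l v" "l \<noteq> 0"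
    and conv: "convex_family d n l v" and m: "1 \<le> m" "m \<le> d"
  shows "\<not> (seq_det (skip 0 (\<lambda>k. v (j + int k))) * seq_det (skip (d + 1) (\<lambda>k. v (j + int k))) > 0 \<and>
            seq_det (skip 0 (\<lambda>k. v (j + int k))) * seq_det (skip m (\<lambda>k. v (j + int k))) < 0)"
proof
  let ?x = "\<lambda>k. v (j + int k)"
  let ?D = "\<lambda>k. seq_det (skip k ?x)"
  assume bad: "?D 0 * ?D (d + 1) > 0 \<and> ?D 0 * ?D m < 0"
  have indep: "lin_indep_on ?x S" if "S \<subseteq> {..d + 1}" "card S \<le> d + 1" for S
    using that n by (intro general_family_window[OF gen _ qp]) (auto simp: CARD)
  define Z where "Z = {1..d} - {m}"
  have cardZ: "card Z = d - 1"
    using m by (simp add: Z_def)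
  let ?I = "(\<lambda>k. (j + int k) mod int n) ` Z"
  have "inj_on (\<lambda>k. (j + int k) mod int n) Z"
  proof (rule inj_onI)
    fix a b assume ab: "a \<in> Z" "b \<in> Z" "(j + int a) mod int n = (j + int b) mod int n"
    have "j + int a = j + int b"
      by (rule inj_onD[OF inj_on_mod_window[of n j]]) (use ab n in \<open>auto simp: Z_def\<close>)
    then show "a = b"
      by simp
  qed
  then have "card ?I = d - 1"
    using cardZ by (simp only: card_image)
  moreover have "?I \<subseteq> {0..<int n}"
    using n by (intro image_subsetI) simp
  ultimately have "\<exists>f. convex_support d n l v f \<and> (\<forall>i\<in>?I. f \<bullet> v i = 0)"
    using conv unfolding convex_family_def by blast
  then obtain f where f: "convex_support d n l v f" and fI: "\<And>i. i \<in> ?I \<Longrightarrow> f \<bullet> v i = 0"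
    by blast
  define \<phi> where "\<phi> k = f \<bullet> ?x k" for k
  have \<phi>Z: "\<phi> k = 0" if "k \<in> Z" for k
    using fI[of "(j + int k) mod int n"] that quasi_periodic_mod[OF qp, of "j + int k"]
    by (simp add: \<phi>_def)
  \<comment> \<open>The signs at \<open>Z\<close> are free, so a pattern \<open>p\<close> has to
    respect \<open>f\<close> only at \<open>0\<close>, \<open>m\<close> and \<open>d + 1\<close>.
    The window has \<open>d + 1\<close> neighbouring pairs; \<open>d\<close> changes among them are
    one too many.\<close>
  have bound: False if p: "\<And>k. p k \<noteq> 0" "\<And>k. k \<in> {0, m, d + 1} \<Longrightarrow> \<phi> k \<noteq> 0 \<Longrightarrow> p k * \<phi> k > 0"
    and changes: "d \<le> card {k \<in> {..<d + 1}. p k * p (Suc k) < 0}" for p :: "nat \<Rightarrow> real"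
  proof -
    have "card {k \<in> {..<d + 1}. p k * p (Suc k) < 0} \<le> d - 1"
    proof (rule convex_support_window_bound[OF f qp])
      show "p k * (f \<bullet> v (j + int k)) > 0" if "k \<le> d + 1" "f \<bullet> v (j + int k) \<noteq> 0" for k
        using that p(2)[of k] \<phi>Z[of k] unfolding \<phi>_def Z_def by fastforce
    qed (use n p in auto)
    then show False
      using changes m by simp
  qed
  \<comment> \<open>\<open>\<psi>\<close> and \<open>\<omega>\<close> are the values of
    \<open>f\<close> at \<open>m\<close> and \<open>d + 1\<close> measured against alternating
    signs: where they are nonzero, the pattern \<open>\<sigma> * (-1) ^ k\<close> is admissible iff
    \<open>\<sigma>\<close> has their sign.\<close>
  define \<psi> where "\<psi> = (-1) ^ m * \<phi> m"
  define \<omega> where "\<omega> = (-1) ^ (d + 1) * \<phi> (d + 1)"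
  have \<phi>_m: "\<phi> m = (-1) ^ m * \<psi>" and \<phi>_last: "\<phi> (d + 1) = (-1) ^ (d + 1) * \<omega>"
    by (simp_all add: \<psi>_def \<omega>_def)
  have "(\<Sum>k\<le>CARD('n). ((-1) ^ k * ?D k) *\<^sub>R ?x k) = 0"
    by (rule seq_det_skip_relation) (rule indep, auto simp: CARD)
  then have "f \<bullet> (\<Sum>k\<le>CARD('n). ((-1) ^ k * ?D k) *\<^sub>R ?x k) = 0"
    by (simp only: inner_zero_right)
  then have "(\<Sum>k\<le>d + 1. (-1) ^ k * ?D k * \<phi> k) = 0"
    by (simp only: inner_sum_right inner_scaleR_right \<phi>_def CARD)
  moreover have "(\<Sum>k\<le>d + 1. (-1) ^ k * ?D k * \<phi> k) = (\<Sum>k\<in>{0, m, d + 1}. (-1) ^ k * ?D k * \<phi> k)"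
    using m by (intro sum.mono_neutral_right) (auto simp: \<phi>Z Z_def)
  moreover have "\<dots> = ?D 0 * \<phi> 0 + ?D m * \<psi> + ?D (d + 1) * \<omega>"
    using m by (simp add: \<psi>_def \<omega>_def)
  ultimately have rel: "?D 0 * \<phi> 0 + ?D m * \<psi> + ?D (d + 1) * \<omega> = 0"
    by simp
  show False
  proof (cases "\<phi> 0 * \<psi> < 0")
    case False
    define \<sigma> :: real where "\<sigma> = (if \<phi> 0 < 0 \<or> \<psi> < 0 then -1 else 1)"
    have \<sigma>: "\<sigma> \<noteq> 0" "\<sigma> * \<sigma> = 1" "\<phi> 0 \<noteq> 0 \<Longrightarrow> \<sigma> * \<phi> 0 > 0" "\<psi> \<noteq> 0 \<Longrightarrow> \<sigma> * \<psi> > 0"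
      using False by (auto simp: \<sigma>_def mult_less_0_iff)
    \<comment> \<open>Strict alternation on \<open>0, ..., d\<close> fits both at \<open>0\<close>
      and at \<open>m\<close> and already yields \<open>d\<close> changes; the last entry just
      follows \<open>f\<close>.\<close>
    define p where "p k = (if k \<le> d then \<sigma> * (-1) ^ k else if \<phi> k \<noteq> 0 then \<phi> k else 1)" for k
    show False
    proof (rule bound)
      show "p k \<noteq> 0" for k
        using \<sigma> by (simp add: p_def)
      show "p k * \<phi> k > 0" if "k \<in> {0, m, d + 1}" "\<phi> k \<noteq> 0" for k
      proof -
        consider "k = 0" | "k = m" | "k = d + 1"
          using \<open>k \<in> {0, m, d + 1}\<close> by blast
        then show ?thesis
        proof cases
          case 1
          then show ?thesis
            using \<sigma>(3) that by (simp add: p_def)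
        next
          case 2
          then have "p k * \<phi> k = \<sigma> * \<psi>" "\<psi> \<noteq> 0"
            using m that by (auto simp: p_def \<phi>_m)
          then show ?thesis
            using \<sigma>(4) by simp
        next
          case 3
          then show ?thesis
            using that by (auto simp: p_def zero_less_mult_iff)
        qed
      qed
      have "p k * p (Suc k) < 0" if "k < d" for k
        using that alternating_mult_neg[OF \<sigma>(1), of k] by (simp add: p_def del: power_Suc)
      then have "{..<d} \<subseteq> {k \<in> {..<d + 1}. p k * p (Suc k) < 0}"
        by auto
      then have "card {..<d} \<le> card {k \<in> {..<d + 1}. p k * p (Suc k) < 0}"
        by (intro card_mono) auto
      then show "d \<le> card {k \<in> {..<d + 1}. p k * p (Suc k) < 0}"
        by simp
    qed
  next
    case True
    define \<sigma> :: real where "\<sigma> = sgn (\<phi> 0)"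
    have \<sigma>: "\<sigma> \<noteq> 0" "\<sigma> * \<sigma> = 1" "\<sigma> * \<phi> 0 > 0" "\<sigma> * \<psi> < 0"
      using True by (auto simp: \<sigma>_def sgn_if mult_less_0_iff)
    \<comment> \<open>The first two terms of the relation have the same sign, as both pairs of
      factors disagree. The third must balance them, and \<open>?D (d + 1)\<close> has the sign of
      \<open>?D 0\<close>, so \<open>\<omega>\<close> is opposite to
      \<open>\<phi> 0\<close>.\<close>
    have "?D 0 * ?D (d + 1) * (\<sigma> * \<omega>) = - ((?D 0 * ?D 0) * (\<sigma> * \<phi> 0)) - (?D 0 * ?D m) * (\<sigma> * \<psi>)"
      using arg_cong[OF rel, of "\<lambda>t. ?D 0 * \<sigma> * t"] by (simp add: algebra_simps)
    also have "\<dots> < 0"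
    proof -
      have "(?D 0 * ?D 0) * (\<sigma> * \<phi> 0) > 0"
        by (rule mult_pos_pos) (use bad \<sigma> in \<open>auto simp: zero_less_mult_iff\<close>)
      moreover have "(?D 0 * ?D m) * (\<sigma> * \<psi>) > 0"
        by (rule mult_neg_neg) (use bad \<sigma> in auto)
      ultimately show ?thesis
        by linarith
    qed
    finally have \<omega>: "\<sigma> * \<omega> < 0"
      using mult_less_cancel_left_pos[OF conjunct1[OF bad], of "\<sigma> * \<omega>" 0] by simp
    \<comment> \<open>Alternation with a single fault between \<open>m - 1\<close> and
      \<open>m\<close>, after which the pattern fits \<open>\<psi>\<close> and
      \<open>\<omega>\<close>. All other \<open>d\<close> pairs change sign.\<close>
    define p where "p k = (if k < m then \<sigma> * (-1) ^ k else - \<sigma> * (-1) ^ k)" for k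
    show False
    proof (rule bound)
      show "p k \<noteq> 0" for k
        using \<sigma> by (simp add: p_def)
      show "p k * \<phi> k > 0" if "k \<in> {0, m, d + 1}" "\<phi> k \<noteq> 0" for k
      proof -
        consider "k = 0" | "k = m" | "k = d + 1"
          using \<open>k \<in> {0, m, d + 1}\<close> by blast
        then show ?thesis
        proof cases
          case 1
          then show ?thesis
            using \<sigma>(3) m by (simp add: p_def)
        next
          case 2
          then have "p k * \<phi> k = - (\<sigma> * \<psi>)"
            by (simp add: p_def \<phi>_m)
          then show ?thesis
            using \<sigma>(4) by simp
        next
          case 3
          then have "p k * \<phi> k = - (\<sigma> * \<omega>)"
            using m by (simp add: p_def \<phi>_last[simplified])
          then show ?thesis
            using \<omega> by simp
        qed
      qed
      have "p k * p (Suc k) < 0" if "k \<noteq> m - 1" for k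
      proof -
        have "k < m \<longleftrightarrow> Suc k < m"
          using that m by linarith
        then show ?thesis
          using alternating_mult_neg[OF \<sigma>(1), of k] by (simp add: p_def del: power_Suc)
      qed
      then have "{..<d + 1} - {m - 1} \<subseteq> {k \<in> {..<d + 1}. p k * p (Suc k) < 0}"
        by auto
      then have "card ({..<d + 1} - {m - 1}) \<le> card {k \<in> {..<d + 1}. p k * p (Suc k) < 0}"
        by (intro card_mono) auto
      then show "d \<le> card {k \<in> {..<d + 1}. p k * p (Suc k) < 0}"
        using m by simp
    qed
  qed
qed

subsection \<open>Deleting a vertex\<close>

text \<open>The index \<open>q * n + r\<close> with \<open>0 \<le> r < n\<close> goes to
  \<open>q * (n + 1) + r\<close>. So all indices congruent to \<open>n\<close> modulo
  \<open>n + 1\<close> are skipped at once, and the factor \<open>l\<close> is kept.\<close>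

definition delete_last :: "nat \<Rightarrow> (int \<Rightarrow> 'a) \<Rightarrow> int \<Rightarrow> 'a" where
  "delete_last n v i = v (i + i div int n)"

lemma delete_last_eq:
  "0 \<le> i \<Longrightarrow> i < int n \<Longrightarrow> delete_last n v i = v i"
  by (simp add: delete_last_def)

lemma delete_last_eq_Suc:
  assumes "int n \<le> i" "i < 2 * int n"
  shows "delete_last n v i = v (i + 1)"
proof -
  have "i div int n = 1"
    using assms by (intro int_div_pos_eq[of _ _ _ "i - int n"]) auto
  then show ?thesis
    by (simp add: delete_last_def)
qed

lemma quasi_periodic_delete_last:
  assumes "quasi_periodic (Suc n) l v" "n > 0"
  shows "quasi_periodic n l (delete_last n v)"
proof -
  have "delete_last n v (i + int n) = v ((i + i div int n) + int (Suc n))" for i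
    using assms(2) by (simp add: delete_last_def algebra_simps)
  then show ?thesis
    using quasi_periodicD[OF assms(1)] by (simp add: quasi_periodic_def delete_last_def)
qed

lemma general_family_delete_last:
  fixes v :: "int \<Rightarrow> real ^ 'n::finite"
  assumes "general_family (Suc n) v"
  shows "general_family n (delete_last n v)"
  unfolding general_family_def
proof (intro allI impI)
  fix J assume J: "J \<subseteq> {0..<int n}" "card J = CARD('n)"
  then have "J \<subseteq> {0..<int (Suc n)}"
    by auto
  then have "lin_indep_on v J"
    using assms J(2) unfolding general_family_def by simp
  moreover have "delete_last n v j = v j" if "j \<in> J" for j
    using J that by (intro delete_last_eq) auto
  ultimately show "lin_indep_on (delete_last n v) J"
    by (simp add: lin_indep_on_def cong: sum.cong)
qed

text \<open>A sign sequence of the subpolygon becomes one of the whole polygon by inserting an entry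
  at the deleted vertex, and an insertion never lowers the number of sign changes. Hence
  \<open>f\<close> itself remains a support.\<close>

lemma convex_support_delete_last:
  fixes v :: "int \<Rightarrow> real ^ 'n::finite"
  assumes supp: "convex_support d (Suc n) l v f" and qp: "quasi_periodic (Suc n) l v" "l \<noteq> 0" and n: "n > 0"
  shows "convex_support d n l (delete_last n v) f"
  unfolding convex_support_def
proof (intro conjI allI impI)
  show "f \<noteq> 0"
    using supp by (simp add: convex_support_def)
  fix t assume t: "quasi_periodic n l t" "\<forall>i. t i \<noteq> 0" and
    tf: "\<forall>i. f \<bullet> delete_last n v i \<noteq> 0 \<longrightarrow> t i * (f \<bullet> delete_last n v i) > 0"
  define p where "p i = (if i < int n then t i else if f \<bullet> v i \<noteq> 0 then f \<bullet> v i else 1)" for i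
  have p0: "p i \<noteq> 0" for i
    using t(2) by (simp add: p_def)
  obtain s where s: "quasi_periodic (Suc n) l s" "\<And>i. s i \<noteq> 0" "\<And>i. i \<in> {0..<0 + int (Suc n)} \<Longrightarrow> s i = p i"
    by (rule quasi_periodic_extension[of "Suc n" l 0 p, OF zero_less_Suc qp(2) p0]) auto
  have "s i * (f \<bullet> v i) > 0" if "f \<bullet> v i \<noteq> 0" for i
  proof (rule quasi_periodic_same_sign_all[OF s(1) quasi_periodic_inner[OF qp(1)] qp(2) _ _ that])
    fix i assume i: "i \<in> {0..<0 + int (Suc n)}" "f \<bullet> v i \<noteq> 0"
    show "s i * (f \<bullet> v i) > 0"
    proof (cases "i < int n")
      case True
      then show ?thesis
        using tf[rule_format, of i] i s(3)[OF i(1)] delete_last_eq[of i n v] by (simp add: p_def)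
    next
      case False
      then show ?thesis
        using i s(3)[OF i(1)] by (auto simp: p_def zero_less_mult_iff)
    qed
  qed simp
  then have "sign_changes (Suc n) s \<le> d - 1"
    using supp s unfolding convex_support_def by blast
  moreover have "sign_changes n t \<le> sign_changes (Suc n) s"
  proof (rule sign_changes_interlacing)
    fix i assume i: "i \<in> {0..int n}"
    show "t i * s i > 0 \<or> t i * s (i + 1) > 0"
    proof (cases "i < int n")
      case True
      then show ?thesis
        using i s(3)[of i] t by (auto simp: p_def zero_less_mult_iff)
    next
      case False
      then have "i = int n"
        using i by simp
      \<comment> \<open>Beyond the inserted entry the indices differ by one: \<open>t n\<close> and
        \<open>s (n + 1)\<close> both continue the entry at \<open>0\<close>.\<close>
      then have "t i = l * t 0" "s (i + 1) = l * s 0"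
        using quasi_periodicD[OF t(1), of 0] quasi_periodicD[OF s(1), of 0] by (simp_all add: add.commute)
      then have "s (i + 1) = t i"
        using s(3)[of 0] n by (simp add: p_def)
      then show ?thesis
        using t(2) by (auto simp: zero_less_mult_iff linorder_neq_iff)
    qed
  qed (rule s)
  ultimately show "sign_changes n t \<le> d - 1"
    by linarith
qed

lemma convex_family_delete_last:
  fixes v :: "int \<Rightarrow> real ^ 'n::finite"
  assumes "convex_family d (Suc n) l v" "quasi_periodic (Suc n) l v" "l \<noteq> 0" "n > 0"
  shows "convex_family d n l (delete_last n v)"
  unfolding convex_family_def
proof (intro allI impI)
  fix I assume I: "I \<subseteq> {0..<int n}" "card I = d - 1"
  then have "I \<subseteq> {0..<int (Suc n)}"
    by auto
  then obtain f where f: "convex_support d (Suc n) l v f" "\<And>i. i \<in> I \<Longrightarrow> f \<bullet> v i = 0"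
    using assms(1) I unfolding convex_family_def by blast
  have "f \<bullet> delete_last n v i = 0" if "i \<in> I" for i
    using f(2)[OF that] delete_last_eq[of i n v] I that by auto
  then show "\<exists>f. convex_support d n l (delete_last n v) f \<and> (\<forall>i\<in>I. f \<bullet> delete_last n v i = 0)"
    using convex_support_delete_last[OF f(1) assms(2-4)] by blast
qed

lemma sign_changes_window_det_delete_last:
  fixes v :: "int \<Rightarrow> real ^ 'n::finite"
  assumes CARD: "CARD('n) = d + 1" and n: "d + 1 \<le> n"
    and gen: "general_family (Suc n) v" and qp: "quasi_periodic (Suc n) l v" "l \<noteq> 0"
    and conv: "convex_family d (Suc n) l v"
  shows "sign_changes n (window_det (delete_last n v)) \<le> sign_changes (Suc n) (window_det v)"
proof (rule sign_changes_interlacing)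
  show nz: "window_det v i \<noteq> 0" for i
    using n CARD by (intro window_det_nonzero[OF gen _ qp]) auto
  let ?w = "delete_last n v"
  have nz': "window_det ?w i \<noteq> 0" for i
    using n CARD by (intro window_det_nonzero[OF general_family_delete_last[OF gen]
          _ quasi_periodic_delete_last[OF qp(1)] qp(2)]) auto
  fix i assume i: "i \<in> {0..int n}"
  \<comment> \<open>The deleted vertex has index \<open>n\<close>: the window starts after it, ends
    before it, or jumps over it. In the last case \<open>m\<close> below is its position in the
    window.\<close>
  consider "i = int n" | "i + int d < int n" | "i < int n" "int n \<le> i + int d"
    using i by fastforce
  then show "window_det ?w i * window_det v i > 0 \<or> window_det ?w i * window_det v (i + 1) > 0"
  proof cases
    case 1
    then have "window_det ?w i = window_det v (i + 1)"
      unfolding window_det_def using n CARD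
      by (intro seq_det_cong) (simp add: delete_last_eq_Suc algebra_simps)
    then show ?thesis
      using nz[of "i + 1"] by (auto simp: zero_less_mult_iff)
  next
    case 2
    then have "window_det ?w i = window_det v i"
      unfolding window_det_def using i CARD
      by (intro seq_det_cong) (simp add: delete_last_eq)
    then show ?thesis
      using nz[of i] by (auto simp: zero_less_mult_iff)
  next
    case 3
    define m where "m = nat (int n - i)"
    have m: "1 \<le> m" "m \<le> d" "i + int m = int n"
      using 3 by (auto simp: m_def)
    let ?x = "\<lambda>k. v (i + int k)"
    have eq: "window_det ?w i = seq_det (skip m ?x)"
      unfolding window_det_def
    proof (rule seq_det_cong)
      fix k assume k: "k < CARD('n)"
      show "?w (i + int k) = skip m ?x k"
      proof (cases "k < m")
        case True
        then show ?thesis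
          using m i by (simp add: skip_def delete_last_eq)
      next
        case False
        then show ?thesis
          using m i 3 k n CARD by (simp add: skip_def delete_last_eq_Suc algebra_simps)
      qed
    qed
    have "window_det v (i + 1) = seq_det (skip 0 ?x)"
      unfolding window_det_def by (intro seq_det_cong) (simp add: skip_def algebra_simps)
    moreover have "window_det v i = seq_det (skip (d + 1) ?x)"
      unfolding window_det_def using CARD by (intro seq_det_cong) (simp add: skip_def)
    moreover have "d + 2 \<le> Suc n"
      using n by simp
    \<comment> \<open>If the two neighbouring determinants of \<open>v\<close> have different signs,
      one of them agrees with the new one anyway; equal signs are the case settled by
      \<open>convex_family_window\<close>.\<close>
    ultimately show ?thesis
      using convex_family_window[OF CARD _ gen qp conv m(1,2), of i] nz[of i] nz[of "i + 1"] nz'[of i]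
      by (auto simp: eq zero_less_mult_iff mult_less_0_iff)
  qed
qed

text \<open>For \<open>n = d + 1\<close> the next window arises by moving the first vector to the
  end and multiplying it by \<open>l\<close>. Consecutive determinants thus have the constant ratio
  \<open>(-1) ^ d * l\<close>, and only its sign has to be found.\<close>

lemma convex_family_simplex:
  fixes v :: "int \<Rightarrow> real ^ 'n::finite"
  assumes CARD: "CARD('n) = d + 1" and d: "d \<ge> 1"
    and gen: "general_family (d + 1) v" and qp: "quasi_periodic (d + 1) l v" "l \<noteq> 0"
    and conv: "convex_family d (d + 1) l v"
  shows "sign_changes (d + 1) (window_det v) = d + 1"
proof -
  have l: "(-1) ^ d * l < 0"
  proof (rule ccontr)
    assume "\<not> (-1) ^ d * l < 0"
    moreover have "(-1) ^ d * l \<noteq> 0"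
      using qp(2) by simp
    ultimately have pos: "(-1) ^ d * l > 0"
      by linarith
    have "{1..<int d} \<subseteq> {0..<int (d + 1)}"
      by auto
    moreover have "card {1..<int d} = d - 1"
      by simp
    ultimately have "\<exists>f. convex_support d (d + 1) l v f \<and> (\<forall>i\<in>{1..<int d}. f \<bullet> v i = 0)"
      using conv unfolding convex_family_def by blast
    then obtain f where f: "convex_support d (d + 1) l v f" and f0: "\<And>i. i \<in> {1..<int d} \<Longrightarrow> f \<bullet> v i = 0"
      by blast
    \<comment> \<open>Only the entries at \<open>0\<close> and \<open>d\<close> can be forced by
      \<open>f\<close>. The sign \<open>\<sigma>\<close> obeys \<open>f\<close> at \<open>0\<close>,
      the entry \<open>d\<close> copies \<open>f\<close> where it is nonzero there, and the others
      alternate.\<close>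
    define \<sigma> :: real where "\<sigma> = (if f \<bullet> v 0 < 0 then -1 else 1)"
    define p where "p i = (if i = int d \<and> f \<bullet> v i \<noteq> 0 then f \<bullet> v i else \<sigma> * (-1) ^ nat i)" for i
    have p0: "p i \<noteq> 0" for i
      by (auto simp: p_def \<sigma>_def)
    obtain s where s: "quasi_periodic (d + 1) l s" "\<And>i. s i \<noteq> 0" "\<And>i. i \<in> {0..<0 + int (d + 1)} \<Longrightarrow> s i = p i"
      by (rule quasi_periodic_extension[of "d + 1" l 0 p, OF _ qp(2) p0]) auto
    have "s i * (f \<bullet> v i) > 0" if "f \<bullet> v i \<noteq> 0" for i
    proof (rule quasi_periodic_same_sign_all[OF s(1) quasi_periodic_inner[OF qp(1)] qp(2) _ _ that])
      fix i assume i: "i \<in> {0..<0 + int (d + 1)}" "f \<bullet> v i \<noteq> 0"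
      then have "i = 0 \<or> i = int d"
        using f0[of i] by fastforce
      then show "s i * (f \<bullet> v i) > 0"
        using i s(3)[OF i(1)] d by (auto simp: p_def \<sigma>_def zero_less_mult_iff)
    qed simp
    then have "sign_changes (d + 1) s \<le> d - 1"
      using f s unfolding convex_support_def by blast
    have alt: "s (int k) = \<sigma> * (-1) ^ k" if "k < d" for k
      using s(3)[of "int k"] that by (simp add: p_def)
    have wrap: "s (int d + 1) = l * \<sigma>"
      using quasi_periodicD[OF s(1), of 0] alt[of 0] d by (simp add: add.commute)
    \<comment> \<open>Whatever the sign at \<open>d\<close>, the entries at \<open>d - 1\<close> and
      \<open>d + 1\<close> differ in sign, so one more change happens between them. With the
      \<open>d - 1\<close> changes before, there are \<open>d\<close>.\<close>
    have "(s (int (d - 1)) * s (int d)) * (s (int d) * s (int d + 1)) < 0"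
    proof -
      have "s (int (d - 1)) * s (int d + 1) = (\<sigma> * \<sigma>) * ((-1) ^ (d - 1) * l)"
        using alt[of "d - 1"] wrap d by simp
      also have "\<dots> = - ((-1) ^ d * l)"
        using d by (cases d) (auto simp: \<sigma>_def)
      finally have "s (int (d - 1)) * s (int d + 1) < 0"
        using pos by simp
      then have "(s (int d) * s (int d)) * (s (int (d - 1)) * s (int d + 1)) < 0"
        by (rule mult_pos_neg[rotated]) (use s(2)[of "int d"] in \<open>auto simp: zero_less_mult_iff\<close>)
      then show ?thesis
        by (simp add: mult_ac)
    qed
    then have "s (int (d - 1)) * s (int d) < 0 \<or> s (int d) * s (int d + 1) < 0"
      by (meson mult_nonneg_nonneg not_less)
    moreover have "int (d - 1) + 1 = int d"
      using d by simp
    ultimately obtain k where k: "k = d - 1 \<or> k = d" "s (int k) * s (int k + 1) < 0"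
      by metis
    have "{..<d - 1} \<union> {k} \<subseteq> {k \<in> {..<d + 1}. s (int k) * s (int k + 1) < 0}"
    proof -
      have "s (int j) * s (int j + 1) < 0" if "j < d - 1" for j
        using alt[of j] alt[of "Suc j"] that by (simp add: \<sigma>_def add.commute)
      then show ?thesis
        using k by auto
    qed
    then have "card ({..<d - 1} \<union> {k}) \<le> card {k \<in> {..<d + 1}. s (int k) * s (int k + 1) < 0}"
      by (intro card_mono) auto
    moreover have "card ({..<d - 1} \<union> {k}) = d"
      using k d by auto
    moreover have "card {k \<in> {..<d + 1}. s (int k) * s (int k + 1) < 0} = sign_changes (d + 1) s"
      by (rule sign_changes_eq_card_nat[symmetric])
    ultimately show False
      using \<open>sign_changes (d + 1) s \<le> d - 1\<close> d by linarith
  qed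
  have step: "window_det v (i + 1) = (-1) ^ d * l * window_det v i" for i
  proof -
    let ?x = "\<lambda>k. v (i + int k)"
    let ?y = "\<lambda>k. if k < d then ?x (Suc k) else if k = d then ?x 0 else ?x k"
    have dlt: "d < CARD('n)"
      using CARD by simp
    have "window_det v (i + 1) = seq_det (?y(d := l *\<^sub>R ?x 0))"
      unfolding window_det_def
    proof (rule seq_det_cong)
      fix k assume "k < CARD('n)"
      then show "v (i + 1 + int k) = (?y(d := l *\<^sub>R ?x 0)) k"
        using CARD quasi_periodicD[OF qp(1), of i] by (auto simp: algebra_simps)
    qed
    also have "\<dots> = l * seq_det (?y(d := ?x 0))"
      using linear_scale[OF linear_seq_det[OF dlt]] by simp
    also have "?y(d := ?x 0) = ?y"
      by auto
    also have "seq_det ?y = (-1) ^ d * seq_det ?x"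
      by (rule seq_det_rotate[OF dlt])
    finally show ?thesis
      by (simp add: window_det_def)
  qed
  have "window_det v i * window_det v (i + 1) < 0" for i
  proof -
    have "window_det v i \<noteq> 0"
      using CARD by (intro window_det_nonzero[OF gen _ qp]) auto
    then have "window_det v i * window_det v i > 0"
      by (auto simp: zero_less_mult_iff)
    with l have "((-1) ^ d * l) * (window_det v i * window_det v i) < 0"
      by (rule mult_neg_pos)
    moreover have "window_det v i * window_det v (i + 1) = ((-1) ^ d * l) * (window_det v i * window_det v i)"
      by (simp only: step mult_ac)
    ultimately show ?thesis
      by (simp only:)
  qed
  then have "{i \<in> {0..<int (d + 1)}. window_det v i * window_det v (i + 1) < 0} = {0..<int (d + 1)}"
    by blast
  then show ?thesis
    by (simp only: sign_changes_def) simp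
qed

theorem convex_family_sign_changes:
  fixes v :: "int \<Rightarrow> real ^ 'n::finite"
  assumes "CARD('n) = d + 1" "d \<ge> 1" "l \<noteq> 0"
    and "d + 1 \<le> n" "general_family n v" "quasi_periodic n l v" "convex_family d n l v"
  shows "d + 1 \<le> sign_changes n (window_det v)"
  using assms(4-7)
proof (induction n arbitrary: v rule: dec_induct)
  case base
  then show ?case
    using convex_family_simplex assms(1-3) by fastforce
next
  case (step n)
  have "n > 0"
    using step.hyps by simp
  then have "d + 1 \<le> sign_changes n (window_det (delete_last n v))"
    using step.prems assms(3)
    by (intro step.IH general_family_delete_last quasi_periodic_delete_last convex_family_delete_last)
  also have "\<dots> \<le> sign_changes (Suc n) (window_det v)"
    using step assms by (intro sign_changes_window_det_delete_last) auto
  finally show ?case .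
qed

subsection \<open>Homogeneous coordinates\<close>

lemma proj_pt_scaleR:
  assumes "c \<noteq> 0"
  shows "proj_pt (c *\<^sub>R x) = proj_pt x"
proof -
  have "span {c *\<^sub>R x} = span {x}"
    using span_image_scale[of "{x}" "\<lambda>_. c"] assms by simp
  then show ?thesis
    by (simp add: proj_pt_def)
qed

lemma proj_pt_eqD:
  assumes "proj_pt x = proj_pt y" "x \<noteq> 0" "y \<noteq> 0"
  obtains c where "c \<noteq> 0" "y = c *\<^sub>R x"
proof -
  have "span {x} = span {y}"
    using assms line_proj_pt by metis
  then have "y \<in> span {x}"
    by (simp add: span_base)
  then obtain c where "y = c *\<^sub>R x"
    by (auto simp: span_singleton)
  with that assms(3) show thesis
    by (cases "c = 0") auto
qed

lemma proj_pt_cases: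
  fixes X :: "('n::finite) projspace"
  obtains x where "x \<noteq> 0" "X = proj_pt x"
proof -
  have L: "subspace (line X)" "dim (line X) = 1"
    using line[of X] by auto
  obtain B where B: "B \<subseteq> line X" "independent B" "line X \<subseteq> span B" "card B = 1"
    using basis_exists[of "line X"] L(2) by metis
  obtain x where x: "B = {x}"
    using B(4) by (auto simp: card_1_singleton_iff)
  have "span B = line X"
    using B(1,3) L(1) span_minimal by blast
  then have "X = proj_pt x"
    unfolding proj_pt_def using x by (metis line_inverse)
  moreover have "x \<noteq> 0"
    using B(2) x by (auto simp: dependent_zero)
  ultimately show thesis
    using that by blast
qed

lemma proj_pt_mem_hyperplane_iff:
  assumes "x \<noteq> 0" "f \<noteq> 0"
  shows "proj_pt x \<in> hyperplane (proj_pt f) \<longleftrightarrow> f \<bullet> x = 0"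
proof
  assume "proj_pt x \<in> hyperplane (proj_pt f)"
  then have "x \<bullet> f = 0"
    using assms by (simp add: hyperplane_def line_proj_pt span_base)
  then show "f \<bullet> x = 0"
    by (simp add: inner_commute)
next
  assume "f \<bullet> x = 0"
  then show "proj_pt x \<in> hyperplane (proj_pt f)"
    using assms by (auto simp: hyperplane_def line_proj_pt span_singleton inner_commute)
qed

lemma continuous_on_proj_pt: "continuous_on (- {0}) proj_pt"
proof -
  have "open (proj_pt -` B \<inter> - {0})" if "open B" for B :: "'a projspace set"
  proof -
    have "proj_pt -` B \<inter> - {0} = {v. v \<noteq> 0 \<and> proj_pt v \<in> B}"
      by auto
    then show ?thesis
      using that by (simp add: open_projspace_def)
  qed
  then show ?thesis
    by (simp add: continuous_on_open_vimage open_Compl)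
qed

subsection \<open>The double cover of projective space by the sphere\<close>

text \<open>The library's theory of covering spaces needs normed spaces, so projective space is replaced by
  its embedding into the space of matrices that maps a line to the orthogonal projection onto it.\<close>

definition line_projection :: "real ^ 'n \<Rightarrow> real ^ 'n ^ 'n::finite" where
  "line_projection x = (\<chi> i j. x $ i * x $ j / (x \<bullet> x))"

lemma line_projection_mult: "line_projection x *v w = ((x \<bullet> w) / (x \<bullet> x)) *\<^sub>R x"
proof -
  have "(\<Sum>j\<in>UNIV. x $ i * x $ j / (x \<bullet> x) * w $ j) = (\<Sum>j\<in>UNIV. x $ j * w $ j) / (x \<bullet> x) * x $ i" for i
  proof -
    have "(\<Sum>j\<in>UNIV. x $ i * x $ j / (x \<bullet> x) * w $ j) = (\<Sum>j\<in>UNIV. (x $ j * w $ j) * (x $ i / (x \<bullet> x)))"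
      by (rule sum.cong) auto
    also have "\<dots> = (\<Sum>j\<in>UNIV. x $ j * w $ j) * (x $ i / (x \<bullet> x))"
      by (rule sum_distrib_right[symmetric])
    finally show ?thesis
      by simp
  qed
  then show ?thesis
    by (simp add: vec_eq_iff matrix_vector_mult_def line_projection_def inner_vec_def)
qed

lemma line_projection_scaleR: "c \<noteq> 0 \<Longrightarrow> line_projection (c *\<^sub>R x) = line_projection x"
  by (simp add: line_projection_def vec_eq_iff)

lemma continuous_on_line_projection: "continuous_on (- {0}) line_projection"
  unfolding line_projection_def by (intro continuous_intros) auto

definition proj_matrix :: "('n::finite) projspace \<Rightarrow> real ^ 'n ^ 'n" where
  "proj_matrix X = line_projection (SOME x. x \<noteq> 0 \<and> X = proj_pt x)"

lemma proj_matrix_proj_pt: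
  assumes "x \<noteq> 0"
  shows "proj_matrix (proj_pt x) = line_projection x"
proof -
  define y where "y = (SOME y. y \<noteq> 0 \<and> proj_pt x = proj_pt y)"
  have "y \<noteq> 0 \<and> proj_pt x = proj_pt y"
    unfolding y_def by (rule someI[of _ x]) (use assms in simp)
  then obtain c where "c \<noteq> 0" "y = c *\<^sub>R x"
    using proj_pt_eqD assms by metis
  then show ?thesis
    using line_projection_scaleR by (simp add: proj_matrix_def flip: y_def)
qed

lemma continuous_on_proj_matrix: "continuous_on UNIV proj_matrix"
proof -
  have "open (proj_matrix -` B)" if "open B" for B :: "(real ^ 'a ^ 'a) set"
  proof -
    have "{v. v \<noteq> 0 \<and> proj_pt v \<in> proj_matrix -` B} = line_projection -` B \<inter> - {0}"
      by (auto simp: proj_matrix_proj_pt)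
    moreover have "open (line_projection -` B \<inter> - {0})"
      using continuous_on_line_projection[where 'a = 'a] that by (simp add: continuous_on_open_vimage open_Compl)
    ultimately show ?thesis
      by (simp add: open_projspace_def)
  qed
  then show ?thesis
    by (simp add: continuous_on_open_vimage)
qed

lemma line_projection_in_image:
  assumes "x \<noteq> 0"
  shows "line_projection x \<in> line_projection ` sphere 0 1"
  using line_projection_scaleR[of "1 / norm x" x] assms
  by (intro image_eqI[of _ _ "(1 / norm x) *\<^sub>R x"]) auto

text \<open>For \<open>\<sigma>\<close> equal to 1 or -1 this formula is a section of the double
  cover off the hyperplane orthogonal to \<open>w\<close>: it picks the unit vector of the line
  whose inner product with \<open>w\<close> has sign \<open>\<sigma>\<close>. It inverts the
  covering locally and lifts curves that avoid a hyperplane.\<close>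

lemma lift_of_line_projection:
  assumes "x \<noteq> 0" "x \<bullet> w \<noteq> 0"
  shows "(\<sigma> / norm (line_projection x *v w)) *\<^sub>R (line_projection x *v w) = (\<sigma> * sgn (x \<bullet> w) / norm x) *\<^sub>R x"
proof -
  have "x \<bullet> x > 0"
    using assms(1) by simp
  then show ?thesis
    using assms by (simp add: line_projection_mult sgn_if field_simps)
qed

lemma covering_space_line_projection:
  "covering_space (sphere 0 1) line_projection (line_projection ` sphere 0 1)"
proof
  have sub: "sphere 0 1 \<subseteq> (- {0} :: (real ^ 'a) set)"
    by auto
  show cont: "continuous_on (sphere 0 1 :: (real ^ 'a) set) line_projection"
    by (rule continuous_on_subset[OF continuous_on_line_projection sub])
  fix y assume "y \<in> line_projection ` (sphere 0 1 :: (real ^ 'a) set)"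
  then obtain a :: "real ^ 'a" where a: "norm a = 1" "y = line_projection a"
    by auto
  let ?S = "sphere 0 1 :: (real ^ 'a) set" and ?R = "line_projection ` (sphere 0 1 :: (real ^ 'a) set)"
  \<comment> \<open>The evenly covered neighbourhood consists of the projections onto lines not
    orthogonal to \<open>a\<close>; its sheets are the two open hemispheres \<open>U 1\<close> and
    \<open>U (-1)\<close>.\<close>
  define T where "T = ?R \<inter> {M. a \<bullet> (M *v a) > 0}"
  define U where "U c = ?S \<inter> {x. c * (x \<bullet> a) > 0}" for c :: real
  have form: "a \<bullet> (line_projection x *v a) = (x \<bullet> a)\<^sup>2" if "norm x = 1" for x
    using that by (simp add: line_projection_mult power2_norm_eq_inner[symmetric] power2_eq_square inner_commute)
  have contM: "continuous_on A (\<lambda>M :: real ^ 'a ^ 'a. M *v a)" for A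
    unfolding matrix_vector_mult_def by (intro continuous_intros)
  have yT: "y \<in> T"
    using a by (auto simp: T_def form power2_norm_eq_inner[symmetric] simp flip: power2_norm_eq_inner)
  have openT: "openin (top_of_set ?R) T"
    unfolding T_def by (intro openin_open_Int open_Collect_less contM continuous_intros)
  have openU: "openin (top_of_set ?S) (U c)" for c
    unfolding U_def by (intro openin_open_Int open_Collect_less continuous_intros)
  have preim: "\<Union>{U 1, U (-1)} = ?S \<inter> line_projection -` T"
  proof -
    have "line_projection x \<in> T \<longleftrightarrow> x \<bullet> a \<noteq> 0" if "norm x = 1" for x
      using that by (simp add: T_def form)
    then show ?thesis
      by (auto simp: U_def)
  qed
  have disj: "pairwise disjnt {U 1, U (-1)}"
    by (auto simp: pairwise_def disjnt_def U_def)
  have homeo: "homeomorphism (U c) T line_projection (\<lambda>M. (c / norm (M *v a)) *\<^sub>R (M *v a))"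
    if c: "c = 1 \<or> c = -1" for c :: real
  proof -
    let ?q = "\<lambda>M. (c / norm (M *v a)) *\<^sub>R (M *v a)"
    have q: "?q (line_projection x) = (c * sgn (x \<bullet> a)) *\<^sub>R x" if "norm x = 1" "x \<bullet> a \<noteq> 0" for x
      using lift_of_line_projection[of x a c] that by fastforce
    have Tcases: thesis if "M \<in> T" "\<And>x. norm x = 1 \<Longrightarrow> x \<bullet> a \<noteq> 0 \<Longrightarrow> M = line_projection x \<Longrightarrow> thesis" for M thesis
      using that by (auto simp: T_def form)
    show ?thesis
    proof (rule homeomorphismI)
      show "continuous_on (U c) line_projection"
        by (rule continuous_on_subset[OF cont]) (auto simp: U_def)
      show "continuous_on T ?q"
      proof (intro continuous_on_scaleR continuous_on_divide continuous_on_const continuous_on_norm contM ballI)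
        fix M assume "M \<in> T"
        then show "norm (M *v a) \<noteq> 0"
          by (auto simp: T_def)
      qed
      show "line_projection ` U c \<subseteq> T"
        using c by (auto simp: U_def T_def form)
      show "?q ` T \<subseteq> U c"
      proof (rule image_subsetI)
        fix M assume "M \<in> T"
        then obtain x where x: "norm x = 1" "x \<bullet> a \<noteq> 0" "M = line_projection x"
          by (rule Tcases)
        then show "?q M \<in> U c"
          using c by (auto simp: q U_def sgn_if)
      qed
      show "?q (line_projection x) = x" if "x \<in> U c" for x
      proof -
        have "norm x = 1" "x \<bullet> a \<noteq> 0" "c * sgn (x \<bullet> a) = 1"
          using that c by (auto simp: U_def sgn_if)
        then show ?thesis
          using q[of x] by simp
      qed
      show "line_projection (?q M) = M" if M: "M \<in> T" for M
      proof -
        obtain x where x: "norm x = 1" "x \<bullet> a \<noteq> 0" "M = line_projection x"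
          using M by (rule Tcases)
        then have nz: "c * sgn (x \<bullet> a) \<noteq> 0"
          using c by (auto simp: sgn_if)
        show ?thesis
          unfolding x(3) q[OF x(1,2)] by (rule line_projection_scaleR[OF nz])
      qed
    qed
  qed
  show "\<exists>T. y \<in> T \<and> openin (top_of_set ?R) T \<and>
          (\<exists>v. \<Union> v = ?S \<inter> line_projection -` T \<and> (\<forall>u\<in>v. openin (top_of_set ?S) u) \<and>
            pairwise disjnt v \<and> (\<forall>u\<in>v. \<exists>q. homeomorphism u T line_projection q))"
    using yT openT openU preim disj homeo
    by (intro exI[of _ T] exI[of _ "{U 1, U (-1)}"] conjI) blast+
qed simp

subsection \<open>Separation in terms of lifted curves\<close>

lemma path_proj_pt:
  assumes "path \<gamma>" "0 \<notin> path_image \<gamma>"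
  shows "path (proj_pt \<circ> \<gamma>)"
  by (rule path_continuous_image[OF assms(1)], rule continuous_on_subset[OF continuous_on_proj_pt])
    (use assms(2) in auto)

text \<open>The open half-space of \<open>k\<close> is convex and avoids the origin, so
  \<open>\<gamma>\<close> closed by a straight segment contracts inside it. The segment misses the
  hyperplane because \<open>f\<close> has the same sign at both ends. Without the half-space, a
  curve in the plane could wind around the origin.\<close>

lemma not_separated_proj_pt:
  fixes \<gamma> :: "real \<Rightarrow> real ^ 'n::finite"
  assumes \<gamma>: "path \<gamma>" and k: "\<And>x. x \<in> path_image \<gamma> \<Longrightarrow> k \<bullet> x > 0"
    and f: "(f \<bullet> pathstart \<gamma>) * (f \<bullet> pathfinish \<gamma>) > 0"
  shows "not_separated (proj_pt \<circ> \<gamma>) (proj_pt f)"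
proof -
  let ?l = "linepath (pathfinish \<gamma>) (pathstart \<gamma>)" and ?H = "{x. k \<bullet> x > 0}"
  have f0: "f \<noteq> 0"
    using f by auto
  have H: "x \<noteq> 0" if "k \<bullet> x > 0" for x
    using that by auto
  have "convex ?H"
    by (rule convex_halfspace_gt)
  have ends: "pathstart \<gamma> \<in> ?H" "pathfinish \<gamma> \<in> ?H"
    using k by auto
  then have l: "path_image ?l \<subseteq> ?H"
    using \<open>convex ?H\<close> by (simp add: closed_segment_subset)
  have fl: "f \<bullet> x \<noteq> 0" if "x \<in> path_image ?l" for x
  proof -
    obtain u where u: "0 \<le> u" "u \<le> 1" "x = (1 - u) *\<^sub>R pathfinish \<gamma> + u *\<^sub>R pathstart \<gamma>"
      using \<open>x \<in> path_image ?l\<close> by (auto simp: closed_segment_def)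
    have "(f \<bullet> x) * (f \<bullet> pathstart \<gamma>) =
        (1 - u) * ((f \<bullet> pathstart \<gamma>) * (f \<bullet> pathfinish \<gamma>)) + u * (f \<bullet> pathstart \<gamma>)\<^sup>2"
      by (simp add: u inner_add_right algebra_simps power2_eq_square)
    also have "\<dots> > 0"
    proof (cases "u = 1")
      case True
      then show ?thesis using f by auto
    next
      case False
      then show ?thesis
        using u mult_pos_pos[OF _ f, of "1 - u"] by (intro add_pos_nonneg) auto
    qed
    finally show ?thesis
      by auto
  qed
  have loop: "path_image (\<gamma> +++ ?l) \<subseteq> ?H"
    using k l by (intro subset_path_image_join) auto
  have closed: "path (\<gamma> +++ ?l)" "path (\<lambda>_ :: real. pathstart \<gamma>)"
    "pathfinish (\<gamma> +++ ?l) = pathstart (\<gamma> +++ ?l)"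
    "pathfinish (\<lambda>_. pathstart \<gamma>) = pathstart (\<lambda>_. pathstart \<gamma>)"
    using \<gamma> by simp_all (simp_all add: path_def pathstart_def pathfinish_def)
  have "homotopic_loops ?H (\<gamma> +++ ?l) (\<lambda>_. pathstart \<gamma>)"
  proof (rule homotopic_loops_linear)
    show "closed_segment ((\<gamma> +++ ?l) t) (pathstart \<gamma>) \<subseteq> ?H" if "t \<in> {0..1}" for t
    proof (rule closed_segment_subset[OF _ ends(1) \<open>convex ?H\<close>])
      show "(\<gamma> +++ ?l) t \<in> ?H"
        using that loop unfolding path_image_def by blast
    qed
  qed (fact closed)+
  moreover have "continuous_on ?H proj_pt"
    by (rule continuous_on_subset[OF continuous_on_proj_pt]) (use H in auto)
  ultimately have "homotopic_loops UNIV (proj_pt \<circ> (\<gamma> +++ ?l)) (proj_pt \<circ> (\<lambda>_. pathstart \<gamma>))"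
    by (rule homotopic_loops_continuous_image) auto
  then have "contractible_loop ((proj_pt \<circ> \<gamma>) +++ (proj_pt \<circ> ?l))"
    unfolding contractible_loop_def path_compose_join by (auto simp: o_def)
  moreover have "path (proj_pt \<circ> ?l)"
    using l H by (intro path_proj_pt) auto
  moreover have "path_image (proj_pt \<circ> ?l) \<inter> hyperplane (proj_pt f) = {}"
  proof -
    have "proj_pt x \<notin> hyperplane (proj_pt f)" if "x \<in> path_image ?l" for x
      using proj_pt_mem_hyperplane_iff[of x f] fl[OF that] f0 H l that by blast
    then show ?thesis
      unfolding path_image_compose by blast
  qed
  moreover have "proj_pt (pathstart \<gamma>) \<notin> hyperplane (proj_pt f)" "proj_pt (pathfinish \<gamma>) \<notin> hyperplane (proj_pt f)"
    using proj_pt_mem_hyperplane_iff[of _ f] f0 H ends f by auto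
  ultimately show ?thesis
    unfolding not_separated_def by (auto simp: pathstart_compose pathfinish_compose)
qed

text \<open>A closing curve \<open>c\<close> that avoids the hyperplane lifts to one side of it.
  Starting at the end of the lifted \<open>\<gamma>\<close>, it must finish antipodally to the start
  of \<open>\<gamma>\<close>, which lies on the other side. But by monodromy the lift of a
  contractible loop closes up.\<close>

lemma separated_proj_pt:
  fixes \<gamma> :: "real \<Rightarrow> real ^ 'n::finite"
  assumes \<gamma>: "path \<gamma>" "0 \<notin> path_image \<gamma>"
    and f: "(f \<bullet> pathstart \<gamma>) * (f \<bullet> pathfinish \<gamma>) < 0"
  shows "separated (proj_pt \<circ> \<gamma>) (proj_pt f)"
proof -
  have f0: "f \<noteq> 0" and fs: "f \<bullet> pathstart \<gamma> \<noteq> 0" and ff: "f \<bullet> pathfinish \<gamma> \<noteq> 0"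
    using f by auto
  have ends: "pathstart \<gamma> \<noteq> 0" "pathfinish \<gamma> \<noteq> 0"
    using fs ff by auto
  have "\<not> not_separated (proj_pt \<circ> \<gamma>) (proj_pt f)"
  proof
    assume "not_separated (proj_pt \<circ> \<gamma>) (proj_pt f)"
    then obtain c where c: "path c" "pathstart c = proj_pt (pathfinish \<gamma>)" "pathfinish c = proj_pt (pathstart \<gamma>)"
      "path_image c \<inter> hyperplane (proj_pt f) = {}" "contractible_loop ((proj_pt \<circ> \<gamma>) +++ c)"
      unfolding not_separated_def by (auto simp: pathstart_compose pathfinish_compose)
    let ?S = "sphere 0 1 :: (real ^ 'n) set" and ?R = "line_projection ` (sphere 0 1 :: (real ^ 'n) set)"
    have range: "proj_matrix X \<in> ?R" for X :: "'n projspace"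
      using line_projection_in_image proj_matrix_proj_pt by (metis proj_pt_cases)
    define L where "L = proj_matrix \<circ> ((proj_pt \<circ> \<gamma>) +++ c)"
    obtain X where "homotopic_loops UNIV ((proj_pt \<circ> \<gamma>) +++ c) (\<lambda>_. X)"
      using c(5) unfolding contractible_loop_def by blast
    then have "homotopic_loops ?R L (proj_matrix \<circ> (\<lambda>_. X))"
      unfolding L_def using continuous_on_proj_matrix range
      by (intro homotopic_loops_continuous_image) auto
    moreover have "proj_matrix \<circ> (\<lambda>_. X) = linepath (proj_matrix X) (proj_matrix X)"
      by (simp add: fun_eq_iff)
    ultimately have hom: "homotopic_paths ?R L (linepath (pathstart L) (pathstart L))"
      by (metis homotopic_loops_imp_homotopic_paths_null)
    \<comment> \<open>The side on which \<open>\<gamma>\<close> ends; with this sign the section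
      \<open>r\<close> lifts \<open>c\<close> so that it continues the lift of
      \<open>\<gamma>\<close>.\<close>
    define \<sigma> where "\<sigma> = sgn (f \<bullet> pathfinish \<gamma>)"
    define r where "r M = (\<sigma> / norm (M *v f)) *\<^sub>R (M *v f)" for M :: "real ^ 'n ^ 'n"
    have \<sigma>: "\<sigma> \<noteq> 0" "\<sigma> * sgn (f \<bullet> pathfinish \<gamma>) = 1" "\<sigma> * sgn (f \<bullet> pathstart \<gamma>) = -1"
      using f by (auto simp: \<sigma>_def sgn_if mult_less_0_iff)
    have r: "r (line_projection x) = (\<sigma> * sgn (f \<bullet> x) / norm x) *\<^sub>R x" if "x \<noteq> 0" "f \<bullet> x \<noteq> 0" for x
      using lift_of_line_projection[of x f \<sigma>] that by (simp add: r_def inner_commute)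
    define G where "G t = (1 / norm (\<gamma> t)) *\<^sub>R \<gamma> t" for t
    define C where "C = r \<circ> (proj_matrix \<circ> c)"
    have \<gamma>0: "\<gamma> t \<noteq> 0" if "t \<in> {0..1}" for t
      using \<gamma>(2) that by (auto simp: path_image_def)
    have cf: thesis if "t \<in> {0..1}"
      "\<And>x. x \<noteq> 0 \<Longrightarrow> f \<bullet> x \<noteq> 0 \<Longrightarrow> c t = proj_pt x \<Longrightarrow> thesis" for t thesis
    proof -
      obtain x where x: "x \<noteq> 0" "c t = proj_pt x"
        using proj_pt_cases by blast
      have "c t \<notin> hyperplane (proj_pt f)"
        using c(4) imageI[OF \<open>t \<in> {0..1}\<close>, of c] unfolding path_image_def by blast
      then show thesis
        using that x proj_pt_mem_hyperplane_iff[OF x(1) f0] by auto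
    qed
    have startG: "pathstart G = (1 / norm (pathstart \<gamma>)) *\<^sub>R pathstart \<gamma>"
      and finishG: "pathfinish G = (1 / norm (pathfinish \<gamma>)) *\<^sub>R pathfinish \<gamma>"
      by (simp_all add: pathstart_def pathfinish_def G_def)
    have startC: "pathstart C = pathfinish G"
      unfolding C_def pathstart_compose c(2) finishG proj_matrix_proj_pt[OF ends(2)]
      using r[OF ends(2) ff] \<sigma>(2) by simp
    have finishC: "pathfinish C = - pathstart G"
      unfolding C_def pathfinish_compose c(3) startG proj_matrix_proj_pt[OF ends(1)]
      using r[OF ends(1) fs] \<sigma>(3) by simp
    have pathG: "path G"
      using \<gamma>(1) \<gamma>0 unfolding path_def G_def by (intro continuous_intros) auto
    have pathC: "path C"
      unfolding C_def
    proof (rule path_continuous_image)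
      show "path (proj_matrix \<circ> c)"
        using c(1) continuous_on_subset[OF continuous_on_proj_matrix subset_UNIV] by (rule path_continuous_image)
      have "norm (M *v f) \<noteq> 0" if M: "M \<in> path_image (proj_matrix \<circ> c)" for M
      proof -
        obtain t where t: "t \<in> {0..1}" "M = proj_matrix (c t)"
          using M by (auto simp: path_image_def)
        obtain x where "x \<noteq> 0" "f \<bullet> x \<noteq> 0" "c t = proj_pt x"
          using t(1) by (rule cf)
        then show ?thesis
          by (simp add: t(2) proj_matrix_proj_pt line_projection_mult inner_commute)
      qed
      moreover have "continuous_on A (\<lambda>M :: real ^ 'n ^ 'n. M *v f)" for A
        unfolding matrix_vector_mult_def by (intro continuous_intros)
      ultimately show "continuous_on (path_image (proj_matrix \<circ> c)) r"
        unfolding r_def by (intro continuous_intros) auto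
    qed
    let ?h = "G +++ C"
    have Gt: "norm (G t) = 1" "line_projection (G t) = proj_matrix ((proj_pt \<circ> \<gamma>) t)" if "t \<in> {0..1}" for t
      using \<gamma>0[OF that] by (simp_all add: G_def line_projection_scaleR proj_matrix_proj_pt)
    have Ct: "norm (C t) = 1" "line_projection (C t) = proj_matrix (c t)" if t: "t \<in> {0..1}" for t
    proof -
      obtain x where "x \<noteq> 0" "f \<bullet> x \<noteq> 0" "c t = proj_pt x"
        using t by (rule cf)
      then have "C t = (\<sigma> * sgn (f \<bullet> x) / norm x) *\<^sub>R x" "proj_matrix (c t) = line_projection x"
        "\<bar>\<sigma> * sgn (f \<bullet> x)\<bar> = 1"
        using ff by (auto simp: C_def r proj_matrix_proj_pt \<sigma>_def abs_mult sgn_if)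
      then show "norm (C t) = 1" "line_projection (C t) = proj_matrix (c t)"
        using \<open>x \<noteq> 0\<close> \<open>f \<bullet> x \<noteq> 0\<close> \<sigma>(1) line_projection_scaleR[of "\<sigma> * sgn (f \<bullet> x) / norm x" x]
        by (auto simp: sgn_0_0)
    qed
    have "pathfinish ?h = pathfinish (linepath (pathstart G) (pathstart G))"
    proof (rule covering_space_monodromy[OF covering_space_line_projection _ _ _ _ hom])
      show "path L" "path_image L \<subseteq> ?R"
        using hom homotopic_paths_imp_path homotopic_paths_imp_subset by blast+
      show "path_image (linepath (pathstart L) (pathstart L)) \<subseteq> ?R"
        using hom homotopic_paths_imp_subset by blast
      show "path ?h"
        using pathG pathC startC by simp
      show "path_image ?h \<subseteq> sphere 0 1"
        using Gt(1) Ct(1) by (intro subset_path_image_join) (auto simp: path_image_def)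
      show "line_projection (?h t) = L t" if "t \<in> {0..1}" for t
        using that Gt(2) Ct(2) by (auto simp: L_def joinpaths_def)
      show "path_image (linepath (pathstart G) (pathstart G)) \<subseteq> sphere 0 1"
        using Gt(1)[of 0] by (simp add: pathstart_def)
      have "pathstart L = line_projection (pathstart G)"
        using Gt(2)[of 0] by (simp add: L_def pathstart_def joinpaths_def)
      then show "line_projection (linepath (pathstart G) (pathstart G) t) = linepath (pathstart L) (pathstart L) t" for t
        by simp
    qed (simp_all add: pathstart_join)
    then have "- pathstart G = pathstart G"
      by (simp add: finishC)
    then have "2 *\<^sub>R pathstart G = 0"
      by (metis add.right_inverse scaleR_2)
    then have "pathstart G = 0"
      by simp
    then show False
      using Gt(1)[of 0] by (simp add: pathstart_def)
  qed
  moreover have "proj_pt (pathstart \<gamma>) \<notin> hyperplane (proj_pt f)" "proj_pt (pathfinish \<gamma>) \<notin> hyperplane (proj_pt f)"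
    using proj_pt_mem_hyperplane_iff[of _ f] f0 ends fs ff by auto
  ultimately show ?thesis
    unfolding separated_def by (simp add: pathstart_compose pathfinish_compose)
qed

subsection \<open>Lifting a polygon\<close>

lemma broken_line_compose:
  "broken_line (\<lambda>i. p \<circ> E i) k i = p \<circ> broken_line E k i"
  by (induction k arbitrary: i) (simp_all only: broken_line.simps path_compose_join)

lemma broken_line_linepath:
  fixes v :: "int \<Rightarrow> 'a::real_normed_vector"
  defines "E \<equiv> \<lambda>i. linepath (v i) (v (i + 1))"
  shows "path (broken_line E k i)" "pathstart (broken_line E k i) = v i"
    "pathfinish (broken_line E k i) = v (i + int k + 1)"
    "path_image (broken_line E k i) = (\<Union>j\<in>{i..i + int k}. closed_segment (v j) (v (j + 1)))"
proof -
  have start: "pathstart (broken_line E k i) = v i" for k i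
    by (cases k) (simp_all add: E_def)
  have "path (broken_line E k i) \<and> pathfinish (broken_line E k i) = v (i + int k + 1) \<and>
      path_image (broken_line E k i) = (\<Union>j\<in>{i..i + int k}. closed_segment (v j) (v (j + 1)))"
  proof (induction k arbitrary: i)
    case 0
    then show ?case by (simp add: E_def)
  next
    case (Suc k)
    have "{i..i + int (Suc k)} = insert i {i + 1..i + 1 + int k}"
      by auto
    with Suc show ?case
      by (simp add: E_def start[unfolded E_def] path_image_join algebra_simps)
  qed
  with start show "path (broken_line E k i)" "pathstart (broken_line E k i) = v i"
    "pathfinish (broken_line E k i) = v (i + int k + 1)"
    "path_image (broken_line E k i) = (\<Union>j\<in>{i..i + int k}. closed_segment (v j) (v (j + 1)))"
    by blast+
qed

definition polygon_lift ::
    "nat \<Rightarrow> real \<Rightarrow> (int \<Rightarrow> ('n::finite) projspace) \<Rightarrow> (int \<Rightarrow> real \<Rightarrow> 'n projspace) \<Rightarrow> (int \<Rightarrow> real ^ 'n) \<Rightarrow> bool"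
  where
  "polygon_lift n l V e v \<longleftrightarrow> l \<noteq> 0 \<and> quasi_periodic n l v \<and>
     (\<forall>i. v i \<noteq> 0 \<and> V i = proj_pt (v i) \<and> e i = proj_pt \<circ> linepath (v i) (v (i + 1)))"

text \<open>The coordinate vectors of both endpoints may be rescaled by a common factor, so the
  first can be prescribed. This lets the lifts of consecutive edges fit together.\<close>

lemma segment_path_lift:
  assumes "segment_path a A B" "x \<noteq> 0" "A = proj_pt x"
  obtains y where "y \<noteq> 0" "B = proj_pt y" "a = proj_pt \<circ> linepath x y"
proof -
  obtain v w where vw: "v \<noteq> 0" "w \<noteq> 0" "A = proj_pt v" "B = proj_pt w"
    "a = (\<lambda>t. proj_pt ((1 - t) *\<^sub>R v + t *\<^sub>R w))"
    using assms(1) unfolding segment_path_def by blast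
  obtain c where c: "c \<noteq> 0" "x = c *\<^sub>R v"
    using proj_pt_eqD[of v x] vw assms by metis
  have "a t = proj_pt (linepath x (c *\<^sub>R w) t)" for t
    using proj_pt_scaleR[OF c(1), of "(1 - t) *\<^sub>R v + t *\<^sub>R w"] vw(5) c(2)
    by (simp add: linepath_def scaleR_add_right mult.commute)
  then have "a = proj_pt \<circ> linepath x (c *\<^sub>R w)"
    by (simp add: fun_eq_iff)
  then show thesis
    using that[of "c *\<^sub>R w"] c vw proj_pt_scaleR[OF c(1), of w] by simp
qed

lemma closed_polygon_lift:
  fixes V :: "int \<Rightarrow> ('n::finite) projspace"
  assumes poly: "closed_polygon n V e" and n: "n > 0"
  obtains l v where "polygon_lift n l V e v"
proof -
  have VE: "V (i + int n) = V i" "e (i + int n) = e i" "segment_path (e i) (V i) (V (i + 1))" for i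
    using poly unfolding closed_polygon_def by auto
  obtain x0 where x0: "x0 \<noteq> 0" "V 0 = proj_pt x0"
    by (rule proj_pt_cases)
  have "\<exists>u. \<forall>k. (u k \<noteq> 0 \<and> V (int k) = proj_pt (u k) \<and> (k = 0 \<longrightarrow> u k = x0)) \<and>
      e (int k) = proj_pt \<circ> linepath (u k) (u (Suc k))"
  proof (rule dependent_nat_choice)
    fix x k assume x: "x \<noteq> 0 \<and> V (int k) = proj_pt x \<and> (k = 0 \<longrightarrow> x = x0)"
    obtain y where "y \<noteq> 0" "V (int k + 1) = proj_pt y" "e (int k) = proj_pt \<circ> linepath x y"
      using segment_path_lift[OF VE(3)] x by metis
    then show "\<exists>y. (y \<noteq> 0 \<and> V (int (Suc k)) = proj_pt y \<and> (Suc k = 0 \<longrightarrow> y = x0)) \<and>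
        e (int k) = proj_pt \<circ> linepath x y"
      by (auto simp: add.commute)
  qed (use x0 in auto)
  then obtain u where u: "\<And>k. u k \<noteq> 0" "\<And>k. V (int k) = proj_pt (u k)"
    "\<And>k. e (int k) = proj_pt \<circ> linepath (u k) (u (Suc k))"
    by blast
  have "proj_pt (u 0) = proj_pt (u n)"
    using VE(1)[of 0] u(2)[of 0] u(2)[of n] by simp
  then obtain l where l: "l \<noteq> 0" "u n = l *\<^sub>R u 0"
    using proj_pt_eqD u(1) by metis
  \<comment> \<open>Only \<open>u 0, ..., u n\<close> are kept, where \<open>u n\<close> has
    returned to the line of \<open>u 0\<close>; the rest is redefined by quasi-periodicity. The
    zeros keep the shape of \<open>quasi_periodic_powi_extension\<close> at
    \<open>j = 0\<close>.\<close>
  define v where "v = (\<lambda>i. (l powi ((i - 0) div int n)) *\<^sub>R u (nat (0 + (i - 0) mod int n)))"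
  have qp: "quasi_periodic n l v"
    unfolding v_def by (rule quasi_periodic_powi_extension[OF n l(1)])
  have vu: "v (int k) = u k" if "k \<le> n" for k
  proof (cases "k = n")
    case True
    then show ?thesis
      using l n by (simp add: v_def)
  next
    case False
    then show ?thesis
      using that by (simp add: v_def)
  qed
  have per: "V (i + k * int n) = V i \<and> e (i + k * int n) = e i" for i k
  proof (induction k rule: int_induct[where k = 0])
    case (step1 k)
    then show ?case using VE(1,2)[of "i + k * int n"] by (simp add: algebra_simps)
  next
    case (step2 k)
    then show ?case using VE(1,2)[of "i + (k - 1) * int n"] by (simp add: algebra_simps)
  qed simp
  have "v i \<noteq> 0 \<and> V i = proj_pt (v i) \<and> e i = proj_pt \<circ> linepath (v i) (v (i + 1))" for i
  proof -
    define q where "q = i div int n"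
    define k where "k = nat (i mod int n)"
    have k: "i = int k + q * int n" "k < n"
      using n by (simp_all add: q_def k_def nat_less_iff)
    have c: "l powi q \<noteq> 0"
      using l(1) by simp
    have vi: "v i = (l powi q) *\<^sub>R u k"
      using quasi_periodic_shift[OF qp l(1), of "int k" q] vu[of k] k by simp
    have "v (int (Suc k) + q * int n) = (l powi q) *\<^sub>R u (Suc k)"
      using quasi_periodic_shift[OF qp l(1), of "int (Suc k)" q] vu[of "Suc k"] k(2) by simp
    then have vi1: "v (i + 1) = (l powi q) *\<^sub>R u (Suc k)"
      by (simp add: k(1) algebra_simps)
    have "linepath (v i) (v (i + 1)) t = (l powi q) *\<^sub>R linepath (u k) (u (Suc k)) t" for t
      by (simp add: vi vi1 linepath_def scaleR_add_right mult.commute)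
    then have "proj_pt \<circ> linepath (v i) (v (i + 1)) = proj_pt \<circ> linepath (u k) (u (Suc k))"
      by (simp add: fun_eq_iff proj_pt_scaleR[OF c])
    moreover have "V i = V (int k)" "e i = e (int k)"
      using per[of "int k" q] k(1) by simp_all
    ultimately show ?thesis
      using u[of k] c vi proj_pt_scaleR[OF c, of "u k"] by simp
  qed
  then show thesis
    using that[of l v] l(1) qp by (simp add: polygon_lift_def)
qed

lemma general_position_lift:
  fixes V :: "int \<Rightarrow> ('n::finite) projspace"
  assumes "polygon_lift n l V e v" "general_position d n V" "CARD('n) = d + 1"
  shows "general_family n v"
  unfolding general_family_def
proof (intro allI impI)
  fix J assume J: "J \<subseteq> {0..<int n}" "card J = CARD('n)"
  have fin: "finite J"
    using J(1) finite_subset by blast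
  have "span_dim (V ` J) = int (card J) - 1"
    using assms(2,3) J unfolding general_position_def by simp
  then have "dim (\<Union>X\<in>V ` J. line X) = card J"
    by (simp add: span_dim_def)
  moreover have "line (V i) = span {v i}" for i
    using assms(1) line_proj_pt unfolding polygon_lift_def by metis
  ultimately have "dim (\<Union>i\<in>J. span {v i}) = card J"
    by simp
  moreover have "(\<Union>i\<in>J. span {v i}) \<subseteq> span (v ` J)"
    by (rule UN_least, rule span_mono) auto
  ultimately have "card J \<le> dim (v ` J)"
    by (metis dim_span dim_subset)
  then have "card J \<le> card (v ` J)" "card (v ` J) \<le> dim (v ` J)"
    using dim_le_card'[of "v ` J"] card_image_le[OF fin, of v] fin by auto
  then have "card (v ` J) = card J" "card (v ` J) \<le> dim (v ` J)"
    using card_image_le[OF fin, of v] by auto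
  moreover from this(2) have "independent (v ` J)"
    using fin by (intro card_le_dim_spanning[OF subset_refl span_superset]) auto
  ultimately show "lin_indep_on v J"
    using fin by (simp add: lin_indep_on_iff eq_card_imp_inj_on)
qed

section \<open>Flattenings in terms of the lift\<close>

lemma polygon_lift_edge_nonzero:
  fixes v :: "int \<Rightarrow> real ^ 'n::finite"
  assumes gen: "general_family n v" and qp: "quasi_periodic n l v" "l \<noteq> 0"
    and CARD: "2 \<le> CARD('n)" "CARD('n) \<le> n"
  shows "0 \<notin> closed_segment (v j) (v (j + 1))"
proof
  assume "0 \<in> closed_segment (v j) (v (j + 1))"
  then obtain u where u: "(1 - u) *\<^sub>R v j + u *\<^sub>R v (j + 1) = 0"
    by (auto simp: closed_segment_def)
  let ?c = "\<lambda>k :: nat. if k = 0 then 1 - u else u"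
  have ind: "lin_indep_on (\<lambda>k. v (j + int k)) {0, 1}"
    using CARD by (intro general_family_window[OF gen _ qp]) auto
  have sum: "(\<Sum>k\<in>{0, 1}. ?c k *\<^sub>R v (j + int k)) = 0"
    using u by simp
  have "?c 0 = 0" "?c 1 = 0"
    using lin_indep_onD[OF ind sum] by blast+
  then show False
    by simp
qed

text \<open>The hyperplane is the kernel of \<open>f\<close>, the determinant as a function of its
  first vector. For even \<open>d\<close> it suffices that the lifted broken line avoids the origin
  and has its ends on opposite sides; for odd \<open>d\<close> the line is enclosed in an open
  half-space.\<close>

lemma polygon_lift_flattening:
  fixes V :: "int \<Rightarrow> ('n::finite) projspace"
  assumes lift: "polygon_lift n l V e v" and gen: "general_family n v"
    and CARD: "CARD('n) = d + 1" and n: "d + 1 \<le> n" and d: "d \<ge> 1"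
    and change: "window_det v i * window_det v (i + 1) < 0"
  shows "flattening d V e (i + 1)"
proof -
  have qp: "quasi_periodic n l v" "l \<noteq> 0" and v: "v j \<noteq> 0" "V j = proj_pt (v j)"
    "e j = proj_pt \<circ> linepath (v j) (v (j + 1))" for j
    using lift by (auto simp: polygon_lift_def)
  let ?x = "\<lambda>w k. if k = 0 then w else v (i + int k)"
  have "linear (\<lambda>w. seq_det ((?x 0)(0 := w)))"
    by (rule linear_seq_det) (simp add: CARD)
  then have lin: "linear (\<lambda>w. seq_det (?x w))"
    by (simp add: fun_upd_def if_distrib cong: if_cong)
  define f where "f = adjoint (\<lambda>w. seq_det (?x w)) 1"
  have f: "f \<bullet> w = seq_det (?x w)" for w
    using adjoint_works[OF lin, of w 1] by (simp add: f_def inner_commute)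
  have first: "f \<bullet> v i = window_det v i"
    unfolding f window_det_def by (rule arg_cong[where f = seq_det]) auto
  have last: "f \<bullet> v (i + int d + 1) = (-1) ^ d * window_det v (i + 1)"
  proof -
    let ?y = "?x (v (i + int d + 1))"
    have "seq_det (\<lambda>k. if k < d then ?y (Suc k) else if k = d then ?y 0 else ?y k) = (-1) ^ d * seq_det ?y"
      by (rule seq_det_rotate) (simp add: CARD)
    moreover have "seq_det (\<lambda>k. if k < d then ?y (Suc k) else if k = d then ?y 0 else ?y k) = window_det v (i + 1)"
      unfolding window_det_def by (rule seq_det_cong) (auto simp: CARD less_Suc_eq algebra_simps)
    ultimately show ?thesis
      unfolding f by simp
  qed
  have middle: "f \<bullet> v j = 0" if "j \<in> {i + 1..<i + 1 + int d}" for j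
  proof -
    have "j = i + int (nat (j - i))"
      using that by simp
    then show ?thesis
      unfolding f using that by (intro seq_det_eq_0[of 0 "nat (j - i)"]) (auto simp: CARD)
  qed
  have f0: "f \<noteq> 0"
    using first change by auto
  have hyp: "V ` {i + 1..<i + 1 + int d} \<subseteq> hyperplane (proj_pt f)"
    using middle v f0 by (auto simp: proj_pt_mem_hyperplane_iff)
  let ?E = "\<lambda>i. linepath (v i) (v (i + 1))"
  let ?\<gamma> = "broken_line ?E d i"
  have e: "e = (\<lambda>i. proj_pt \<circ> ?E i)"
    using v(3) by (rule ext)
  have line: "broken_line e d i = proj_pt \<circ> ?\<gamma>"
    unfolding e by (rule broken_line_compose)
  note \<gamma> = broken_line_linepath[of v d i]
  have prod: "(f \<bullet> pathstart ?\<gamma>) * (f \<bullet> pathfinish ?\<gamma>) = (-1) ^ d * (window_det v i * window_det v (i + 1))"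
    unfolding \<gamma>(2,3) first last by (simp only: mult_ac)
  show ?thesis
  proof (cases "even d")
    case True
    have "0 \<notin> closed_segment (v j) (v (j + 1))" for j
      using CARD n d by (intro polygon_lift_edge_nonzero[OF gen qp]) auto
    then have "0 \<notin> path_image ?\<gamma>"
      by (simp add: \<gamma>)
    then have "separated (broken_line e d i) (proj_pt f)"
      unfolding line using True change prod by (intro separated_proj_pt \<gamma>) auto
    then show ?thesis
      unfolding flattening_def using hyp True by auto
  next
    case False
    have ind: "lin_indep_on (\<lambda>k. v (i + 1 + int k)) {..<d}"
      using CARD n by (intro general_family_window[OF gen _ qp]) auto
    obtain a where a: "\<And>k. k \<in> {..<d} \<Longrightarrow> a \<bullet> v (i + 1 + int k) = 1"
      using lin_indep_on_interpolation[OF ind finite_lessThan, of "\<lambda>_. 1"] by blast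
    let ?p = "v i" and ?q = "v (i + int d + 1)"
    have pq: "(f \<bullet> ?p) * (f \<bullet> ?q) > 0"
      using prod change False by (simp add: \<gamma>)
    define \<sigma> where "\<sigma> = sgn (f \<bullet> ?p)"
    have \<sigma>: "\<sigma> * (f \<bullet> ?p) > 0" "\<sigma> * (f \<bullet> ?q) > 0"
      using pq by (auto simp: \<sigma>_def sgn_if zero_less_mult_iff)
    \<comment> \<open>The functional \<open>a\<close> is positive on the middle vectors, where
      \<open>f\<close> vanishes, so a large multiple of \<open>\<sigma> *\<^sub>R f\<close> corrects
      the two ends without disturbing them. Each summand of \<open>K\<close> is positive and large
      enough for one end.\<close>
    define K where "K = (\<bar>a \<bullet> ?p\<bar> + 1) / (\<sigma> * (f \<bullet> ?p)) + (\<bar>a \<bullet> ?q\<bar> + 1) / (\<sigma> * (f \<bullet> ?q))"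
    define k where "k = a + (K * \<sigma>) *\<^sub>R f"
    have K: "a \<bullet> w + K * (\<sigma> * (f \<bullet> w)) > 0" if w: "w \<in> {?p, ?q}" for w
    proof -
      have "(\<bar>a \<bullet> w\<bar> + 1) / (\<sigma> * (f \<bullet> w)) \<le> K"
        using w \<sigma> unfolding K_def by (auto intro!: divide_nonneg_pos)
      then have "\<bar>a \<bullet> w\<bar> + 1 \<le> K * (\<sigma> * (f \<bullet> w))"
        using w \<sigma> by (auto simp: pos_divide_le_eq)
      then show ?thesis
        by linarith
    qed
    have kv: "k \<bullet> v j > 0" if j: "j \<in> {i..i + int d + 1}" for j
    proof -
      consider "v j \<in> {?p, ?q}" | "j \<in> {i + 1..<i + 1 + int d}"
      proof -
        have "j = i \<or> j = i + int d + 1 \<or> j \<in> {i + 1..<i + 1 + int d}"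
          using j by auto
        then show thesis
          using that by blast
      qed
      then show ?thesis
      proof cases
        case 1
        then show ?thesis
          using K[of "v j"] by (simp add: k_def inner_add_left mult.assoc)
      next
        case 2
        then have "j = i + 1 + int (nat (j - i - 1))" "nat (j - i - 1) \<in> {..<d}"
          by auto
        then have "a \<bullet> v j = 1"
          using a by metis
        then show ?thesis
          using middle[OF 2] by (simp add: k_def inner_add_left)
      qed
    qed
    have "k \<bullet> x > 0" if x: "x \<in> path_image ?\<gamma>" for x
    proof -
      obtain j where j: "j \<in> {i..i + int d}" "x \<in> closed_segment (v j) (v (j + 1))"
        using x by (auto simp: \<gamma>)
      then have "closed_segment (v j) (v (j + 1)) \<subseteq> {x. k \<bullet> x > 0}"
        using kv by (intro closed_segment_subset convex_halfspace_gt) auto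
      then show ?thesis
        using j(2) by auto
    qed
    then have "not_separated (broken_line e d i) (proj_pt f)"
      unfolding line using False change prod by (intro not_separated_proj_pt \<gamma>) auto
    then show ?thesis
      unfolding flattening_def using hyp False by auto
  qed
qed

subsection \<open>Strict convexity in terms of the lift\<close>

text \<open>Modulo \<open>n\<close>, some end of the second edge is not an end of the first. The
  three vectors are then independent, so the two planes differ. If they meet only in 0, any nonzero
  \<open>w\<close> serves.\<close>

lemma edge_spans_meet_in_line:
  fixes v :: "int \<Rightarrow> real ^ 'n::finite"
  assumes gen: "general_family n v" and qp: "quasi_periodic n l v" "l \<noteq> 0"
    and CARD: "3 \<le> CARD('n)" "CARD('n) \<le> n"
    and ij: "i \<in> {0..<int n}" "j \<in> {0..<int n}" "i \<noteq> j"
  obtains w where "w \<noteq> 0" "span {v i, v (i + 1)} \<inter> span {v j, v (j + 1)} \<subseteq> span {w}"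
proof -
  let ?S = "span {v i, v (i + 1)}" and ?T = "span {v j, v (j + 1)}"
  have n3: "3 \<le> n"
    using CARD by simp
  have "\<exists>j'\<in>{j, j + 1}. inj_on (\<lambda>k. k mod int n) {i, i + 1, j'} \<and> j' \<noteq> i \<and> j' \<noteq> i + 1"
  proof -
    have ne: "a mod int n \<noteq> b mod int n" if "0 < \<bar>a - b\<bar>" "\<bar>a - b\<bar> < int n" for a b
    proof
      assume "a mod int n = b mod int n"
      then have "int n dvd \<bar>a - b\<bar>"
        by (simp add: mod_eq_dvd_iff)
      then show False
        using that zdvd_imp_le by fastforce
    qed
    \<comment> \<open>The vertex \<open>j\<close> itself works unless the second edge starts where
      the first one ends, possibly across the end of the period; then \<open>j + 1\<close>
      does.\<close>
    consider "j = i + 1" | "j \<noteq> i + 1" "j + int n \<noteq> i + 1"  | "j + int n = i + 1"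
      by blast
    then show ?thesis
    proof cases
      case 1
      then show ?thesis
        using n3 ne[of i "i + 1"] ne[of i "2 + i"] ne[of "i + 1" "2 + i"]
        by (intro bexI[of _ "j + 1"]) (auto simp: inj_on_def)
    next
      case 2
      have "j mod int n \<noteq> (i + 1) mod int n"
      proof (cases "\<bar>j - (i + 1)\<bar> < int n")
        case True
        then show ?thesis
          using ne[of j "i + 1"] 2 by auto
      next
        case False
        then show ?thesis
          using 2 ij(1,2) unfolding atLeastLessThan_iff by linarith
      qed
      then show ?thesis
        using n3 ne[of i "i + 1"] ne[of i j] ij 2
        by (intro bexI[of _ j]) (auto simp: inj_on_def)
    next
      case 3
      have "(j + 1) mod int n = (i + 2) mod int n"
        using mod_add_self2[of "j + 1" "int n"] 3 by (simp add: algebra_simps)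
      then show ?thesis
        using n3 ne[of i "i + 1"] ne[of i "i + 2"] ne[of "i + 1" "i + 2"] 3
        by (intro bexI[of _ "j + 1"]) (auto simp: inj_on_def)
    qed
  qed
  then obtain j' where j': "j' \<in> {j, j + 1}" "inj_on (\<lambda>k. k mod int n) {i, i + 1, j'}" "j' \<noteq> i" "j' \<noteq> i + 1"
    by blast
  have "lin_indep_on v {i, i + 1, j'}"
    using CARD j' by (intro general_family_lin_indep_on[OF gen _ qp]) auto
  then have "inj_on v {i, i + 1, j'}" "independent (v ` {i, i + 1, j'})"
    by (simp_all add: lin_indep_on_iff)
  moreover from this(1) have "v ` {i, i + 1, j'} - {v j'} = {v i, v (i + 1)}"
    using j'(3,4) by (auto simp: inj_on_def)
  ultimately have notin: "v j' \<notin> ?S"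
    unfolding dependent_def by auto
  have sub: "subspace (?S \<inter> ?T)" "subspace ?T"
    by (simp_all add: subspace_inter)
  have "v j' \<in> ?T"
    using j'(1) by (auto intro: span_base)
  then have "?S \<inter> ?T \<noteq> ?T"
    using notin by blast
  then have "\<not> dim ?T \<le> dim (?S \<inter> ?T)"
    using subspace_dim_equal[OF sub] by blast
  moreover have "dim ?T \<le> 2"
    using dim_le_card'[of "{v j, v (j + 1)}"] by (simp add: card_insert_if split: if_splits)
  ultimately have "dim (?S \<inter> ?T) \<le> 1"
    by linarith
  moreover obtain B where B: "?S \<inter> ?T \<subseteq> span B" "card B = dim (?S \<inter> ?T)" "independent B"
    using basis_exists[of "?S \<inter> ?T"] by metis
  ultimately have "card B \<le> 1" "finite B"
    using independent_imp_finite by auto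
  then consider "B = {}" | w where "B = {w}"
    by (metis One_nat_def card_0_eq card_1_singletonE le_SucE le_zero_eq)
  then show thesis
  proof cases
    case 1
    have "v j' \<noteq> 0"
      using notin span_zero by metis
    then show thesis
      using that[of "v j'"] B(1) 1 span_zero by (auto simp: subset_iff)
  next
    case 2
    then show thesis
      using that[of w] B by auto
  qed
qed

text \<open>Finitely many hyperplanes form a null set, and a nonempty open set is none.\<close>

lemma open_avoiding_finite_orthogonality:
  fixes A :: "'a::euclidean_space set"
  assumes "open A" "A \<noteq> {}" "finite W" "0 \<notin> W"
  obtains g where "g \<in> A" "\<And>w. w \<in> W \<Longrightarrow> g \<bullet> w \<noteq> 0"
proof -
  have "negligible (\<Union>w\<in>W. {x. w \<bullet> x = 0})"
    using assms(3,4) by (intro negligible_Union) (auto intro!: negligible_hyperplane)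
  moreover have "\<not> negligible A"
    using assms(1,2) by (rule open_not_negligible)
  ultimately have "\<not> A \<subseteq> (\<Union>w\<in>W. {x. w \<bullet> x = 0})"
    using negligible_subset by blast
  then obtain g where "g \<in> A" "\<forall>w\<in>W. w \<bullet> g \<noteq> 0"
    by auto
  then show thesis
    by (intro that[of g]) (auto simp: inner_commute)
qed

text \<open>Every admissible sign pattern \<open>s\<close> is realised by functionals close to
  \<open>f\<close>. Each of its sign changes makes the nearby hyperplane cut an edge, and the
  multiplicity bounds the number of points so obtained.\<close>

lemma strictly_convex_lift:
  fixes V :: "int \<Rightarrow> ('n::finite) projspace"
  assumes lift: "polygon_lift n l V e v" and gen: "general_family n v"
    and CARD: "CARD('n) = d + 1" and n: "d + 1 \<le> n" and d: "d \<ge> 1"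
    and conv: "strictly_convex d n V e"
  shows "convex_family d n l v"
  unfolding convex_family_def
proof (intro allI impI)
  have qp: "quasi_periodic n l v" "l \<noteq> 0" and v: "v j \<noteq> 0" "V j = proj_pt (v j)"
    "e j = proj_pt \<circ> linepath (v j) (v (j + 1))" for j
    using lift by (auto simp: polygon_lift_def)
  fix I assume I: "I \<subseteq> {0..<int n}" "card I = d - 1"
  then obtain h where h: "V ` I \<subseteq> hyperplane h" "intersects_with_multiplicity V e h (d - 1)"
    using conv unfolding strictly_convex_def by blast
  obtain f where f: "f \<noteq> 0" "h = proj_pt f"
    by (rule proj_pt_cases)
  have fI: "f \<bullet> v i = 0" if "i \<in> I" for i
    using that h(1) proj_pt_mem_hyperplane_iff[OF v(1)[of i] f(1)] unfolding f(2) v(2) by blast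
  obtain U where U: "open U" "h \<in> U" "\<And>h'. h' \<in> U \<Longrightarrow> polygon_transverse V e h' \<Longrightarrow>
        finite (polygon_points e \<inter> hyperplane h') \<and> card (polygon_points e \<inter> hyperplane h') \<le> d - 1"
    using h(2) unfolding intersects_with_multiplicity_def eventually_nhds by blast
  have "convex_support d n l v f"
    unfolding convex_support_def
  proof (intro conjI allI impI)
    show "f \<noteq> 0"
      by (rule f)
    fix s assume s: "quasi_periodic n l s" "\<forall>i. s i \<noteq> 0"
      and sf: "\<forall>i. f \<bullet> v i \<noteq> 0 \<longrightarrow> s i * (f \<bullet> v i) > 0"
    define A where "A = {g. g \<noteq> 0 \<and> proj_pt g \<in> U} \<inter> (\<Inter>i\<in>{0..<int n}. {g. s i * (g \<bullet> v i) > 0})"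
    have openP: "open {g. g \<noteq> 0 \<and> proj_pt g \<in> U}"
      using U(1) by (simp add: open_projspace_def)
    have "open A"
      unfolding A_def by (intro open_Int openP open_INT ballI finite_atLeastLessThan_int
          open_Collect_less continuous_intros)
    moreover have "A \<noteq> {}"
    proof -
      define Z where "Z = {i \<in> {0..<int n}. f \<bullet> v i = 0}"
      have finZ: "finite Z"
        by (rule finite_subset[of _ "{0..<int n}"]) (auto simp: Z_def)
      have "card Z \<le> CARD('n)"
      proof (rule ccontr)
        assume "\<not> card Z \<le> CARD('n)"
        then obtain J where J: "J \<subseteq> Z" "card J = CARD('n)"
          by (metis nat_le_linear obtain_subset_with_card_n)
        then have "J \<subseteq> {0..<int n}"
          by (auto simp: Z_def)
        then have "lin_indep_on v J"
          using gen J(2) unfolding general_family_def by blast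
        then have "f = 0"
          using J finite_subset[OF J(1) finZ]
          by (intro lin_indep_on_orthogonal_eq_0[of v J]) (auto simp: Z_def)
        then show False
          using f(1) by simp
      qed
      moreover have "inj_on (\<lambda>i. i mod int n) Z"
        using inj_on_mod_window[of n 0] by (rule inj_on_subset) (auto simp: Z_def)
      ultimately have "lin_indep_on v Z"
        using finZ CARD n by (intro general_family_lin_indep_on[OF gen _ qp]) auto
      \<comment> \<open>The vectors at which \<open>f\<close> vanishes are independent, so
        \<open>u\<close> can be given the wanted signs there; a small multiple of \<open>u\<close>
        does not disturb the signs of \<open>f\<close> elsewhere.\<close>
      then obtain u where u: "\<And>i. i \<in> Z \<Longrightarrow> u \<bullet> v i = s i"
        using lin_indep_on_interpolation finZ by metis
      have lim: "((\<lambda>\<delta>. f + \<delta> *\<^sub>R u) \<longlongrightarrow> f + 0 *\<^sub>R u) (at_right 0)"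
        by (intro tendsto_intros)
      have "\<forall>\<^sub>F \<delta> in at_right 0. f + \<delta> *\<^sub>R u \<in> {g. g \<noteq> 0 \<and> proj_pt g \<in> U}"
        using f U(2) by (intro topological_tendstoD[OF lim openP]) simp
      moreover have "\<forall>\<^sub>F \<delta> in at_right 0. \<forall>i\<in>{0..<int n}. s i * ((f + \<delta> *\<^sub>R u) \<bullet> v i) > 0"
      proof (rule eventually_ball_finite, simp, rule ballI)
        fix i assume i: "i \<in> {0..<int n}"
        show "\<forall>\<^sub>F \<delta> in at_right 0. s i * ((f + \<delta> *\<^sub>R u) \<bullet> v i) > 0"
        proof (cases "i \<in> Z")
          case True
          have "s i * s i > 0"
            using s(2) by (auto simp: zero_less_mult_iff linorder_neq_iff)
          have "\<forall>\<^sub>F \<delta> :: real in at_right 0. \<delta> > 0"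
            by (rule eventually_at_right_less)
          then show ?thesis
          proof eventually_elim
            case (elim \<delta>)
            have eq: "s i * ((f + \<delta> *\<^sub>R u) \<bullet> v i) = \<delta> * (s i * s i)"
              using True u by (simp add: Z_def inner_add_left)
            show ?case
              unfolding eq using elim \<open>s i * s i > 0\<close> by (rule mult_pos_pos)
          qed
        next
          case False
          then have "s i * ((f + 0 *\<^sub>R u) \<bullet> v i) > 0"
            using i sf by (simp add: Z_def)
          then show ?thesis
            by (intro order_tendstoD(1)[of _ "s i * ((f + 0 *\<^sub>R u) \<bullet> v i)"] tendsto_intros)
        qed
      qed
      ultimately have "\<forall>\<^sub>F \<delta> in at_right 0. f + \<delta> *\<^sub>R u \<in> A"
        by eventually_elim (auto simp: A_def)
      then show ?thesis
        using eventually_happens[of _ "at_right (0::real)"] by fastforce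
    qed
    \<comment> \<open>For \<open>d \<ge> 2\<close> the lines of two distinct edges have at most one
      common point, marked by \<open>w\<close>. A \<open>g\<close> that avoids all these points has
      a hyperplane meeting distinct edges in distinct points, so none is lost in the count.\<close>
    moreover define P where "P = {(i, j). i \<in> {0..<int n} \<and> j \<in> {0..<int n} \<and> i \<noteq> j \<and> 2 \<le> d}"
    have "\<exists>w. w \<noteq> 0 \<and> span {v i, v (i + 1)} \<inter> span {v j, v (j + 1)} \<subseteq> span {w}" if "(i, j) \<in> P" for i j
      using that CARD n edge_spans_meet_in_line[OF gen qp, of i j] unfolding P_def by auto
    then have "\<forall>p\<in>P. \<exists>w. w \<noteq> 0 \<and>
        span {v (fst p), v (fst p + 1)} \<inter> span {v (snd p), v (snd p + 1)} \<subseteq> span {w}"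
      by auto
    then have "\<exists>w. \<forall>p\<in>P. w p \<noteq> 0 \<and>
        span {v (fst p), v (fst p + 1)} \<inter> span {v (snd p), v (snd p + 1)} \<subseteq> span {w p}"
      by (rule bchoice)
    then obtain w where W: "\<forall>p\<in>P. w p \<noteq> 0 \<and>
        span {v (fst p), v (fst p + 1)} \<inter> span {v (snd p), v (snd p + 1)} \<subseteq> span {w p}" ..
    have w: "span {v i, v (i + 1)} \<inter> span {v j, v (j + 1)} \<subseteq> span {w (i, j)}" if "(i, j) \<in> P" for i j
      using bspec[OF W that] by simp
    have "finite P"
      by (rule finite_subset[of _ "{0..<int n} \<times> {0..<int n}"]) (auto simp: P_def)
    then have "finite (w ` P)"
      by (rule finite_imageI)
    moreover have "\<forall>p\<in>P. w p \<noteq> 0"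
      using W by blast
    then have "0 \<notin> w ` P"
      by (metis imageE)
    ultimately obtain g where g: "g \<in> A" "\<And>x. x \<in> w ` P \<Longrightarrow> g \<bullet> x \<noteq> 0"
      using open_avoiding_finite_orthogonality[of A "w ` P"] by blast
    have g0: "g \<noteq> 0" "proj_pt g \<in> U"
      using g(1) by (auto simp: A_def)
    have sg: "s i * (g \<bullet> v i) > 0" for i
    proof -
      obtain k where "i + k * int n \<in> {0..<0 + int n}"
        by (rule shift_into_window[of n i 0]) (use n in auto)
      then have "s (i + k * int n) * (g \<bullet> v (i + k * int n)) > 0"
        using g(1) by (simp add: A_def)
      then show ?thesis
        using quasi_periodic_same_sign(1)[OF s(1) quasi_periodic_inner[OF qp(1)] qp(2)] by blast
    qed
    then have gv: "g \<bullet> v i \<noteq> 0" for i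
      by (metis less_irrefl mult_zero_right)
    let ?F = "polygon_points e \<inter> hyperplane (proj_pt g)"
    \<comment> \<open>Since \<open>g\<close> vanishes at no vertex, every intersection is interior
      to an edge whose ends lie off the hyperplane.\<close>
    have "polygon_transverse V e (proj_pt g)"
      unfolding polygon_transverse_def
    proof
      fix X assume X: "X \<in> ?F"
      then obtain i t where t: "t \<in> {0..1}" "X = e i t"
        by (auto simp: polygon_points_def path_image_def)
      have vh: "proj_pt (v i) \<notin> hyperplane (proj_pt g)" for i
        using proj_pt_mem_hyperplane_iff[OF v(1) g0(1)] gv by blast
      have "X \<noteq> proj_pt (v i)" "X \<noteq> proj_pt (v (i + 1))"
        using X vh by blast+
      then have "t \<noteq> 0" "t \<noteq> 1"
        using t(2) v(3) by (auto simp: linepath_def)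
      then have "X \<in> e i ` {0<..<1}"
        using t by auto
      moreover have "proj_pt (v i) \<in> path_image (e i)"
        using v(3)[of i] by (auto simp: path_image_def linepath_def intro!: image_eqI[of _ _ 0])
      then have "edge_transverse (e i) (proj_pt g)"
        unfolding edge_transverse_def using vh by blast
      ultimately show "transverse_at V e (proj_pt g) X"
        unfolding transverse_at_def by blast
    qed
    then have F: "finite ?F" "card ?F \<le> d - 1"
      using U(3)[OF g0(2)] by blast+
    \<comment> \<open>The zero of the affine function \<open>g\<close> on the lifted edge, by linear
      interpolation between its values at the ends.\<close>
    define x where "x i = linepath (v i) (v (i + 1)) ((g \<bullet> v i) / (g \<bullet> v i - g \<bullet> v (i + 1)))" for i
    let ?C = "{i \<in> {0..<int n}. s i * s (i + 1) < 0}"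
    have x: "x i \<noteq> 0" "g \<bullet> x i = 0" "x i \<in> span {v i, v (i + 1)}" "proj_pt (x i) \<in> ?F" if i: "i \<in> ?C" for i
    proof -
      let ?a = "g \<bullet> v i" and ?b = "g \<bullet> v (i + 1)"
      have ab: "?a * ?b < 0"
        using i sg[of i] sg[of "i + 1"] by (auto simp: zero_less_mult_iff mult_less_0_iff)
      then have ne: "?a - ?b \<noteq> 0"
        by auto
      let ?t = "?a / (?a - ?b)"
      have t: "?t \<in> {0..1}"
        using ab by (cases "?a > 0") (auto simp: mult_less_0_iff divide_simps)
      show span: "x i \<in> span {v i, v (i + 1)}"
        unfolding x_def linepath_def by (intro span_add span_scale span_base) auto
      have "g \<bullet> x i = (1 - ?t) * ?a + ?t * ?b"
        by (simp add: x_def linepath_def inner_add_right)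
      also have "\<dots> = 0"
        using ne by (simp add: field_simps)
      finally show 0: "g \<bullet> x i = 0" .
      show nz: "x i \<noteq> 0"
        using polygon_lift_edge_nonzero[OF gen qp, of i] CARD n d t unfolding x_def
        by (auto simp: linepath_image_01[symmetric] simp del: linepath_image_01)
      have "e i ?t = proj_pt (x i)"
        using v(3) by (simp add: x_def)
      then have "proj_pt (x i) \<in> polygon_points e"
        using t unfolding polygon_points_def path_image_def by (metis UNIV_I UN_I imageI)
      then show "proj_pt (x i) \<in> ?F"
        using proj_pt_mem_hyperplane_iff[OF nz g0(1)] 0 by blast
    qed
    show "sign_changes n s \<le> d - 1"
    proof (cases "2 \<le> d")
      case True
      have "inj_on (\<lambda>i. proj_pt (x i)) ?C"
      proof (rule inj_onI, rule ccontr)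
        fix i j assume i: "i \<in> ?C" and j: "j \<in> ?C" and eq: "proj_pt (x i) = proj_pt (x j)" and ij: "i \<noteq> j"
        obtain c where "x j = c *\<^sub>R x i"
          using proj_pt_eqD[OF eq x(1)[OF i] x(1)[OF j]] .
        then have "x j \<in> span {v i, v (i + 1)}"
          using x(3)[OF i] by (simp add: span_scale)
        moreover have P: "(i, j) \<in> P"
          using i j ij True by (simp add: P_def)
        ultimately have "x j \<in> span {w (i, j)}"
          using w[OF P] x(3)[OF j] by blast
        then obtain c' where "x j = c' *\<^sub>R w (i, j)"
          by (auto simp: span_singleton)
        then show False
          using x(1,2)[OF j] g(2)[of "w (i, j)"] P by auto
      qed
      then have "card ?C \<le> card ?F"
        by (rule card_inj_on_le) (use x(4) F(1) in auto)
      then show ?thesis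
        using F(2) unfolding sign_changes_def by linarith
    next
      case False
      \<comment> \<open>For \<open>d = 1\<close> all edges lie on one line and their points cannot
        be kept apart, but then the bound is 0 and the hyperplane misses the polygon.\<close>
      then have "?F = {}"
        using d F by auto
      then have "?C = {}"
        using x(4) by blast
      then show ?thesis
        unfolding sign_changes_def by (metis card.empty zero_le)
    qed
  qed
  then show "\<exists>f. convex_support d n l v f \<and> (\<forall>i\<in>I. f \<bullet> v i = 0)"
    using fI by blast
qed

theorem theorem3p11:
  fixes d n :: nat
    and V :: "int \<Rightarrow> ('n::finite) projspace"
    and e :: "int \<Rightarrow> real \<Rightarrow> 'n projspace"
  assumes "d \<ge> 1"
    and "CARD('n) = d + 1"
    and "n \<ge> d + 1"
    and "closed_polygon n V e"
    and "general_position d n V"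
    and "strictly_convex d n V e"
  shows "card {i \<in> {0..<int n}. flattening d V e i} \<ge> d + 1"
proof -
  have n: "n > 0"
    using assms(3) by simp
  obtain l v where lift: "polygon_lift n l V e v"
    using closed_polygon_lift[OF assms(4) n] .
  then have qp: "quasi_periodic n l v" "l \<noteq> 0"
    by (simp_all add: polygon_lift_def)
  have gen: "general_family n v"
    by (rule general_position_lift[OF lift assms(5,2)])
  have conv: "convex_family d n l v"
    by (rule strictly_convex_lift[OF lift gen assms(2,3,1,6)])
  let ?D = "window_det v"
  have "d + 1 \<le> sign_changes n ?D"
    by (rule convex_family_sign_changes[OF assms(2,1) qp(2) assms(3) gen qp(1) conv])
  \<comment> \<open>The period starts at \<open>-1\<close> because a sign change between the windows
    at \<open>i\<close> and \<open>i + 1\<close> belongs to the flattening that begins at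
    \<open>i + 1\<close>.\<close>
  also have "\<dots> = card {i \<in> {-1..<-1 + int n}. ?D i * ?D (i + 1) < 0}"
    using qp(2) by (intro sign_changes_window[OF quasi_periodic_window_det[OF qp(1)] _ n]) simp
  also have "\<dots> \<le> card {i \<in> {0..<int n}. flattening d V e i}"
  proof (rule card_inj_on_le)
    show "(\<lambda>i. i + 1) ` {i \<in> {-1..<-1 + int n}. ?D i * ?D (i + 1) < 0} \<subseteq> {i \<in> {0..<int n}. flattening d V e i}"
      using polygon_lift_flattening[OF lift gen assms(2,3,1)] by auto
    show "finite {i \<in> {0..<int n}. flattening d V e i}"
      by (rule finite_subset[of _ "{0..<int n}"]) auto
  qed (simp add: inj_on_def)
  finally show ?thesis .
qed

end
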